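(* Let $n\ge2$ and let $\Sigma_1^{\mathsf{ant}}=S^1\times S^1\subseteq\mathbb{C}\times\mathbb{C}$ with the free $\mathbb{Z}_2$-action $\sigma(x',x'')=(-x',\overline{x''})$, whose quotient is the Klein bottle $K$. Then $\mathsf{TC}^{\mathbb{Z}_2}_{\mathsf{effl},n}(\Sigma_1^{\mathsf{ant}})=2n$.
   Context: For a finite group $G$ acting freely on $X$ with quotient $\pi:X\to X/G$: $M_n(X)$ is the space of $n$-tuples of paths $[0,1]\to X$ with a common starting point, $e_n:M_n(X)\to X^n$ is evaluation at $1$, and $\mathsf{TC}^G_{\mathsf{effl},n}(X)$ is the non-reduced sectional category of $(1\times\pi^{n-1})\circ e_n:M_n(X)\to X\times(X/G)^{n-1}$, i.e. the least number of open sets covering $X\times(X/G)^{n-1}$ each admitting a continuous section. *)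

theory Defs
  imports "HOL-Analysis.Analysis"
begin

definition orb :: "('a \<Rightarrow> 'a) set \<Rightarrow> 'a \<Rightarrow> 'a set" where
  "orb G x = (\<lambda>g. g x) ` G"

text \<open>The orbit space X/G with the quotient topology: points are orbits,
  a set of orbits is open iff its union (the preimage under the projection) is open in X.\<close>
definition orbit_space :: "'a topology \<Rightarrow> ('a \<Rightarrow> 'a) set \<Rightarrow> 'a set topology" where
  "orbit_space X G =
     topology (\<lambda>U. U \<subseteq> orb G ` topspace X \<and> openin X (\<Union>U))"

definition effl_base :: "'a topology \<Rightarrow> ('a \<Rightarrow> 'a) set \<Rightarrow> nat \<Rightarrow> ('a \<times> (nat \<Rightarrow> 'a set)) topology" where
  "effl_base X G n = prod_topology X (product_topology (\<lambda>i. orbit_space X G) {..<n-1})"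

text \<open>A continuous section of (1 \<times> \<pi>^(n-1)) \<circ> e_n : M_n(X) \<rightarrow> X \<times> (X/G)^(n-1) over U,
  written via the exponential law (a continuous map U \<rightarrow> M_n(X), compact-open topology,
  is the same as a continuous map H : U \<times> [0,1] \<rightarrow> X^n): H(u,-) is an n-tuple of paths
  with common start point, and its endpoint tuple is mapped to u.\<close>
definition effl_section_over ::
  "'a topology \<Rightarrow> ('a \<Rightarrow> 'a) set \<Rightarrow> nat \<Rightarrow> ('a \<times> (nat \<Rightarrow> 'a set)) set \<Rightarrow> bool" where
  "effl_section_over X G n U \<longleftrightarrow>
     (\<exists>H :: ('a \<times> (nat \<Rightarrow> 'a set)) \<times> real \<Rightarrow> (nat \<Rightarrow> 'a).
        continuous_map (prod_topology (subtopology (effl_base X G n) U) (top_of_set {0..1}))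
                       (product_topology (\<lambda>i. X) {..<n}) H
      \<and> (\<forall>u\<in>U. (\<forall>i<n. \<forall>j<n. H (u,0) i = H (u,0) j)
                \<and> H (u,1) 0 = fst u
                \<and> (\<forall>i. 1 \<le> i \<and> i < n \<longrightarrow> orb G (H (u,1) i) = snd u (i - 1))))"

text \<open>Non-reduced sectional category: least number of open sets covering the base,
  each admitting a continuous section (\<infinity> if no finite such cover exists).\<close>
definition TC_effl :: "'a topology \<Rightarrow> ('a \<Rightarrow> 'a) set \<Rightarrow> nat \<Rightarrow> enat" where
  "TC_effl X G n = Inf {enat k | k. \<exists>U :: nat \<Rightarrow> ('a \<times> (nat \<Rightarrow> 'a set)) set.
       (\<forall>i<k. openin (effl_base X G n) (U i) \<and> effl_section_over X G n (U i))
     \<and> topspace (effl_base X G n) \<subseteq> (\<Union>i<k. U i)}"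

definition Sigma1_ant :: "(complex \<times> complex) topology" where
  "Sigma1_ant = top_of_set (sphere 0 1 \<times> sphere 0 1)"

definition sigma_ant :: "complex \<times> complex \<Rightarrow> complex \<times> complex" where
  "sigma_ant p = (- fst p, cnj (snd p))"

definition Z2_ant :: "(complex \<times> complex \<Rightarrow> complex \<times> complex) set" where
  "Z2_ant = {id, sigma_ant}"

end

theory Submission
  imports Defs "HOL-Library.Z2"
begin

text \<open>
  Since $X$ is a torus, a section over $U$ amounts to a continuous choice of lifts $\hat y_i \in X$
  of the $y_i \in X/G$ and of logarithms of $\hat y_i / x$. These depend on $N = 2n-1$ circle
  coordinates: $x''$, and for each $i$ the square of $y_i'/x'$ and the coordinate $y_i''$. The
  ambiguity $y_i \mapsto \sigma(y_i)$ preserves the real part of each, so one may cover the base by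
  the sets on which the $k$ largest of these $N$ real parts are separated from the others
  ($0 \le k \le N$), and use on each piece the logarithm that cuts a circle at $-1$ (large real
  part) or at $1$ (small real part).

  For the lower bound restrict the base to $x' = 1$, the product $S^1 \times K^{n-1}$ of
  dimension $N$. The double covers $y_i + v$ (the square root of $y_i''/x''$, up to conjugation)
  become trivial over any open set with a section, so if $N$ sets sufficed then every product of
  $N$ classes $y_i + v$ would vanish in mod 2 cohomology. But $y_i^2$ generates $H^2(K)$ and
  $v^2 = 0$, so $(y_1+v)^3 \prod_{i \ge 2} (y_i+v)^2 = 3\, v\, y_1^2 \cdots y_{n-1}^2 \ne 0$.
\<close>

text \<open>The lower bound works with cochains themselves. Suppose U_0, ..., U_(K-1) cover, with
  sections and K <= N. Let b_k be the sign of the section at points over U_k and the explicit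
  function \<open>wall_cochain\<close> elsewhere. Both change under deck transformations by the same
  character, so the iterated coboundaries built from the b_k and from the explicit functions differ
  by the coboundary of an invariant cochain and have equal sums over a fundamental box. That sum is
  1, so the value on some top cell is nonzero. On a grid finer than a Lebesgue number this closed
  cell lies over a single U_k; there b_k is constant, which forces the value 0.

  In the upper bound the obstacle is that a lift of each y_i must be chosen along with the
  logarithms. For q = y_i'/x' of norm 1, q^2 avoids -1 exactly when Re q is nonzero, and avoids 1
  exactly when Im q is nonzero. The sign of this part of q selects the lift, and multiplying q by
  that sign moves it into a half plane off the cut of the chosen logarithm. So lift and logarithm
  together cost one real condition, which is why N conditions suffice.\<close>

section \<open>Cubical cochains modulo 2\<close>

text \<open>Unfolding addition and multiplication of bits into bitwise operations would defeat
  the normalisation of sums and products.\<close>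
declare add_bit_eq_xor [simp del] mult_bit_eq_and [simp del]

text \<open>A point of $\mathbb{Z}^N$ stands for a cell of the cubical grid with vertices
  $(2\mathbb{Z})^N$: the odd coordinates are the directions in which the cell extends. Equivalently
  the points are the vertices of the barycentric subdivision.\<close>
definition cobd :: "nat \<Rightarrow> ((nat \<Rightarrow> int) \<Rightarrow> bit) \<Rightarrow> (nat \<Rightarrow> int) \<Rightarrow> bit" where
  "cobd N f p = (\<Sum>i | i < N \<and> odd (p i). f (p(i := p i + 1)) + f (p(i := p i - 1)))"

text \<open>If $\delta A = 0$ then $\delta(b A)$ represents $\delta b \cup A$, so the $k$-th cochain
  represents $\delta b_{k-1} \cup \dots \cup \delta b_0$. The functions $b_k$ will only be
  periodic up to a sign character, which makes $\delta b_k$ a nontrivial class on the quotient.\<close>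
primrec cup :: "nat \<Rightarrow> (nat \<Rightarrow> (nat \<Rightarrow> int) \<Rightarrow> bit) \<Rightarrow> nat \<Rightarrow> (nat \<Rightarrow> int) \<Rightarrow> bit" where
  "cup N b 0 = (\<lambda>p. of_bool (\<forall>i<N. even (p i)))"
| "cup N b (Suc k) = cobd N (\<lambda>p. b k p * cup N b k p)"

lemma bit_add_self [simp]: "(a::bit) + a = 0"
  by (cases a) auto

lemma bit_add_self_left [simp]: "(a::bit) + (a + b) = b"
  by (cases a; cases b) auto

lemma cobd_add: "cobd N (\<lambda>p. f p + g p) q = cobd N f q + cobd N g q"
  unfolding cobd_def by (simp add: sum.distrib [symmetric] ac_simps)

text \<open>The terms at (i, j) and (j, i) cancel in characteristic 2; this is the cancellation
  behind \<open>cobd_cobd\<close>.\<close>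

lemma sum_symmetric_off_diagonal_bit:
  fixes F :: "'a \<Rightarrow> 'a \<Rightarrow> bit"
  assumes "finite A" "\<And>i j. F i j = F j i"
  shows "(\<Sum>i\<in>A. \<Sum>j\<in>A - {i}. F i j) = 0"
  using assms(1)
proof (induction A rule: finite_induct)
  case (insert x A)
  have "(\<Sum>i\<in>A. \<Sum>j\<in>insert x A - {i}. F i j) = (\<Sum>i\<in>A. F i x + (\<Sum>j\<in>A - {i}. F i j))"
  proof (rule sum.cong[OF refl])
    fix i assume "i \<in> A"
    then have "insert x A - {i} = insert x (A - {i})" using insert by auto
    then show "(\<Sum>j\<in>insert x A - {i}. F i j) = F i x + (\<Sum>j\<in>A - {i}. F i j)"
      using insert by simp
  qed
  moreover have "insert x A - {x} = A" using insert by auto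
  ultimately show ?case
    using insert assms(2)[of x] by (simp add: sum.distrib)
qed simp

lemma cobd_cobd: "cobd N (cobd N f) p = 0"
proof -
  define A where "A = {i. i < N \<and> odd (p i)}"
  define F where "F i j =
    (f (p(i := p i + 1, j := p j + 1)) + f (p(i := p i + 1, j := p j - 1))) +
    (f (p(i := p i - 1, j := p j + 1)) + f (p(i := p i - 1, j := p j - 1)))" for i j
  define G where "G i j = (if i = j then 0 else F i j)" for i j
  \<comment> \<open>An odd step in direction \<open>i\<close> makes coordinate \<open>i\<close>
    even, so \<open>i\<close> is no longer a direction of the new cell.\<close>
  have odds: "{j. j < N \<and> odd ((p(i := p i + a)) j)} = A - {i}" if "i \<in> A" "odd a" for i a
    using that unfolding A_def by auto
  have odds': "{j. j < N \<and> odd ((p(i := p i - a)) j)} = A - {i}" if "i \<in> A" "odd a" for i a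
    using that unfolding A_def by auto
  have "cobd N (cobd N f) p = (\<Sum>i\<in>A. cobd N f (p(i := p i + 1)) + cobd N f (p(i := p i - 1)))"
    unfolding A_def by (subst cobd_def) simp
  also have "\<dots> = (\<Sum>i\<in>A. \<Sum>j\<in>A - {i}. G i j)"
  proof (rule sum.cong[OF refl])
    fix i assume i: "i \<in> A"
    show "cobd N f (p(i := p i + 1)) + cobd N f (p(i := p i - 1)) = (\<Sum>j\<in>A - {i}. G i j)"
      unfolding cobd_def odds[OF i odd_one] odds'[OF i odd_one] sum.distrib [symmetric]
      by (rule sum.cong) (auto simp: G_def F_def)
  qed
  also have "\<dots> = 0"
  proof (rule sum_symmetric_off_diagonal_bit)
    show "finite A" unfolding A_def by auto
    show "G i j = G j i" for i j
      unfolding G_def F_def by (simp add: fun_upd_twist add_ac)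
  qed
  finally show ?thesis .
qed

lemma cobd_zero: "cobd N (\<lambda>p. 0) q = 0"
  by (simp add: cobd_def)

lemma cobd_cup: "cobd N (cup N b k) p = 0"
proof (cases k)
  case 0
  have "cup N b 0 (p(i := p i + 1)) = cup N b 0 (p(i := p i - 1))" for i
    by simp
  then show ?thesis unfolding 0 cobd_def by (simp del: cup.simps)
qed (simp add: cobd_cobd)

section \<open>Invariance under symmetries of the grid\<close>

definition lattice_symmetry :: "((nat \<Rightarrow> int) \<Rightarrow> nat \<Rightarrow> int) \<Rightarrow> bool" where
  "lattice_symmetry \<gamma> \<longleftrightarrow>
     (\<exists>s c. (\<forall>i. s i = 1 \<or> s i = -1) \<and> (\<forall>i. even (c i)) \<and> \<gamma> = (\<lambda>p i. s i * p i + c i))"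

lemma lattice_symmetry_even:
  assumes "lattice_symmetry \<gamma>"
  shows "even (\<gamma> p i) \<longleftrightarrow> even (p i)"
proof -
  obtain s c where s: "\<And>i. s i = 1 \<or> s i = -1" and "\<And>i. even (c i)"
    and "\<gamma> = (\<lambda>p i. s i * p i + c i)"
    using assms unfolding lattice_symmetry_def by auto
  then show ?thesis using s[of i] by (elim disjE) auto
qed

text \<open>Even translations preserve the directions of a cell, and a reflection merely swaps its
  two facets in one direction, which an unsigned sum does not see.\<close>

lemma cobd_lattice_symmetry:
  assumes "lattice_symmetry \<gamma>"
  shows "cobd N f (\<gamma> p) = cobd N (\<lambda>q. f (\<gamma> q)) p"
proof -
  obtain s c where s: "\<And>i. s i = 1 \<or> s i = -1" and c: "\<And>i. even (c i)"
    and \<gamma>: "\<gamma> = (\<lambda>p i. s i * p i + c i)"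
    using assms unfolding lattice_symmetry_def by auto
  have "f ((\<gamma> p)(i := \<gamma> p i + 1)) + f ((\<gamma> p)(i := \<gamma> p i - 1))
      = f (\<gamma> (p(i := p i + 1))) + f (\<gamma> (p(i := p i - 1)))" for i
  proof -
    have "\<gamma> (p(i := p i + a)) = (\<gamma> p)(i := \<gamma> p i + s i * a)" for a
      unfolding \<gamma> by (auto simp: algebra_simps)
    from this[of 1] this[of "-1"] show ?thesis
      using s[of i] by (auto simp: add.commute)
  qed
  then show ?thesis
    unfolding cobd_def lattice_symmetry_even[OF assms] by simp
qed

text \<open>The defect of \<open>b\<close> is a constant, so it leaves the coboundary as a multiple
  of \<open>cobd N f\<close>. For a cocycle \<open>f\<close> the result is therefore invariant
  although \<open>b * f\<close> need not be.\<close>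

lemma cobd_mult_lattice_symmetry:
  assumes "lattice_symmetry \<gamma>" "\<And>p. b (\<gamma> p) = b p + c" "\<And>p. f (\<gamma> p) = f p"
  shows "cobd N (\<lambda>p. b p * f p) (\<gamma> q) = cobd N (\<lambda>p. b p * f p) q + c * cobd N f q"
proof -
  have "cobd N (\<lambda>p. b p * f p) (\<gamma> q) = cobd N (\<lambda>p. b p * f p + c * f p) q"
    unfolding cobd_lattice_symmetry[OF assms(1)] assms(2,3) by (simp add: algebra_simps)
  also have "\<dots> = cobd N (\<lambda>p. b p * f p) q + c * cobd N f q"
    unfolding cobd_add by (simp add: cobd_def sum_distrib_left distrib_left)
  finally show ?thesis .
qed

lemma cup_lattice_symmetry:
  assumes "lattice_symmetry \<gamma>" "\<And>k. k < K \<Longrightarrow> \<exists>c. \<forall>p. b k (\<gamma> p) = b k p + c" "k \<le> K"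
  shows "cup N b k (\<gamma> p) = cup N b k p"
  using assms(3)
proof (induction k arbitrary: p)
  case 0
  then show ?case by (simp add: lattice_symmetry_even[OF assms(1)])
next
  case (Suc k)
  then obtain c where "\<And>p. b k (\<gamma> p) = b k p + c"
    using assms(2)[of k] by auto
  from cobd_mult_lattice_symmetry[where f = "cup N b k" and b = "b k", OF assms(1) this]
  show ?case using Suc by (simp add: cobd_cup)
qed

text \<open>Counterpart of the fact that a product of degree 1 classes depends only on their
  characters. The invariance of \<open>g\<close> is the point: the difference is a coboundary on the
  quotient, not just on the cover.\<close>

lemma cup_diff_cobd:
  assumes sym: "\<And>\<gamma>. \<gamma> \<in> \<Gamma> \<Longrightarrow> lattice_symmetry \<gamma>"
    and b: "\<And>\<gamma> k. \<gamma> \<in> \<Gamma> \<Longrightarrow> k < K \<Longrightarrow> \<exists>c. \<forall>p. b k (\<gamma> p) = b k p + c \<and> b' k (\<gamma> p) = b' k p + c"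
    and "k \<le> K"
  shows "\<exists>g. (\<forall>\<gamma>\<in>\<Gamma>. \<forall>p. g (\<gamma> p) = g p) \<and> (\<forall>p. cup N b k p = cup N b' k p + cobd N g p)"
  using assms(3)
proof (induction k)
  case 0
  show ?case by (rule exI[of _ "\<lambda>p. 0"]) (simp add: cobd_zero)
next
  case (Suc k)
  then obtain g where g: "\<And>\<gamma> p. \<gamma> \<in> \<Gamma> \<Longrightarrow> g (\<gamma> p) = g p"
    "\<And>p. cup N b k p = cup N b' k p + cobd N g p" by auto
  \<comment> \<open>$b'_k \, \delta g$ is not invariant, but adding the coboundary of $b'_k g$ makes it so.\<close>
  define g' where "g' p = (b k p + b' k p) * cup N b k p
     + (b' k p * cobd N g p + cobd N (\<lambda>p. b' k p * g p) p)" for p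
  have "g' (\<gamma> p) = g' p" if \<gamma>: "\<gamma> \<in> \<Gamma>" for \<gamma> p
  proof -
    obtain c where c: "\<And>p. b k (\<gamma> p) = b k p + c" "\<And>p. b' k (\<gamma> p) = b' k p + c"
      using b[OF \<gamma>, of k] Suc by auto
    have 1: "cup N b k (\<gamma> p) = cup N b k p"
      by (rule cup_lattice_symmetry[OF sym[OF \<gamma>], of K]) (use b[OF \<gamma>] Suc in \<open>blast, simp\<close>)
    have 2: "cobd N g (\<gamma> p) = cobd N g p"
      using cobd_lattice_symmetry[OF sym[OF \<gamma>]] g(1)[OF \<gamma>] by simp
    show ?thesis
      unfolding g'_def 1 2 c cobd_mult_lattice_symmetry[where f = g and b = "b' k", OF sym[OF \<gamma>] c(2) g(1)[OF \<gamma>]]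
      by (cases c) (simp_all add: algebra_simps)
  qed
  moreover have "cup N b (Suc k) p = cup N b' (Suc k) p + cobd N g' p" for p
  proof -
    have "b k p * cup N b k p = b' k p * cup N b' k p + (g' p + cobd N (\<lambda>p. b' k p * g p) p)" for p
    proof -
      have "x * y = x' * y' + ((x + x') * y + x' * d)" if "y = y' + d" for x y x' y' d :: bit
        using that by (cases x; cases x'; cases y'; cases d) simp_all
      from this[OF g(2)] show ?thesis unfolding g'_def by (simp add: add.assoc)
    qed
    then show ?thesis by (simp add: cobd_add cobd_cobd)
  qed
  ultimately show ?case by blast
qed

text \<open>A constant factor commutes with the coboundary and \<open>cup\<close> is closed, so the
  factor at \<open>k\<close> gives 0 on all faces of the top cell \<open>p\<close>, and later
  factors keep it 0. The points \<open>q\<close> are the barycentres of these faces.\<close>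

lemma cup_eq_0_of_const:
  assumes "\<And>i. i < N \<Longrightarrow> odd (p i)" "k < j"
    and const: "\<And>q. (\<And>i. i < N \<Longrightarrow> \<bar>q i - p i\<bar> \<le> 1) \<Longrightarrow> (\<And>i. N \<le> i \<Longrightarrow> q i = p i) \<Longrightarrow> b k q = c"
  shows "(\<forall>i<N. \<bar>q i - p i\<bar> \<le> 1) \<Longrightarrow> (\<forall>i\<ge>N. q i = p i) \<Longrightarrow> cup N b j q = 0"
  using \<open>k < j\<close>
proof (induction j arbitrary: q)
  case (Suc j)
  \<comment> \<open>Since \<open>p i\<close> is odd, an odd \<open>q i\<close> within distance 1
    equals it; so facets of a face of the cell stay in the closed cell.\<close>
  have nb: "(\<forall>l<N. \<bar>(q(i := q i + a)) l - p l\<bar> \<le> 1) \<and> (\<forall>l\<ge>N. (q(i := q i + a)) l = p l)"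
    if "i < N" "odd (q i)" "\<bar>a\<bar> = 1" for i a
  proof -
    have "\<bar>q i - p i\<bar> \<le> 1" "odd (p i)" using Suc assms that by auto
    with \<open>odd (q i)\<close> have "q i = p i" by presburger
    then show ?thesis using Suc that by auto
  qed
  show ?case
  proof (cases "k = j")
    case True
    have "cup N b (Suc j) q = (\<Sum>i | i < N \<and> odd (q i). c * cup N b j (q(i := q i + 1)) + c * cup N b j (q(i := q i - 1)))"
      unfolding cup.simps cobd_def
    proof (rule sum.cong[OF refl], elim CollectE conjE)
      fix i assume i: "i < N" "odd (q i)"
      have "b j (q(i := q i + 1)) = c" "b j (q(i := q i - 1)) = c"
        using nb[OF i, of 1] nb[OF i, of "-1"] const True by auto
      then show "b j (q(i := q i + 1)) * cup N b j (q(i := q i + 1)) + b j (q(i := q i - 1)) * cup N b j (q(i := q i - 1))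
        = c * cup N b j (q(i := q i + 1)) + c * cup N b j (q(i := q i - 1))" by simp
    qed
    also have "\<dots> = c * cobd N (cup N b j) q"
      by (simp add: cobd_def sum_distrib_left distrib_left)
    finally show ?thesis by (simp add: cobd_cup)
  next
    case False
    then have kj: "k < j" using Suc by auto
    have "cup N b j (q(i := q i + 1)) = 0 \<and> cup N b j (q(i := q i - 1)) = 0" if i: "i < N" "odd (q i)" for i
      using Suc.IH[of "q(i := q i + 1)"] Suc.IH[of "q(i := q i - 1)"] nb[OF i, of 1] nb[OF i, of "-1"] kj
      by (simp del: fun_upd_apply)
    then show ?thesis unfolding cup.simps cobd_def by (intro sum.neutral) auto
  qed
qed simp

section \<open>The fundamental class of a circle times Klein bottles\<close>

text \<open>Barycentres of the top cells of the box [0,P]^N, which serves as fundamental domain.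
  Fixing the coordinates from \<open>N\<close> on keeps the set finite.\<close>

definition odd_cells :: "nat \<Rightarrow> int \<Rightarrow> (nat \<Rightarrow> int) set" where
  "odd_cells N P = {p. (\<forall>i<N. odd (p i) \<and> 0 < p i \<and> p i < P) \<and> (\<forall>i\<ge>N. p i = 0)}"

lemma finite_odd_cells: "finite (odd_cells N P)"
proof (rule finite_subset)
  show "odd_cells N P \<subseteq> {p. \<forall>i. (i \<in> {..<N} \<longrightarrow> p i \<in> {0..P}) \<and> (i \<notin> {..<N} \<longrightarrow> p i = 0)}"
    unfolding odd_cells_def by (auto simp: not_less intro: less_imp_le)
qed (rule finite_set_of_finite_funs; simp)

lemma telescope_bit: "(\<Sum>v<h. f (Suc v) + f v) = f h + (f 0 :: bit)"
  by (induction h) (simp_all add: ac_simps)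

text \<open>Along a grid line parallel to axis \<open>i\<close> the facet sums telescope to the two
  ends. Each line is represented by its cell with \<open>i\<close>-th coordinate 1.\<close>

lemma sum_odd_cells_direction:
  fixes f :: "(nat \<Rightarrow> int) \<Rightarrow> bit" and h :: nat
  assumes "i < N" and P: "P = 2 * int h"
  shows "(\<Sum>p\<in>odd_cells N P. f (p(i := p i + 1)) + f (p(i := p i - 1)))
       = (\<Sum>q | q \<in> odd_cells N P \<and> q i = 1. f (q(i := P)) + f (q(i := 0)))"
proof -
  let ?B = "{q. q \<in> odd_cells N P \<and> q i = 1}"
  have "(\<Sum>p\<in>odd_cells N P. f (p(i := p i + 1)) + f (p(i := p i - 1)))
      = (\<Sum>(q, v)\<in>?B \<times> {..<h}. f (q(i := 2 * int (Suc v))) + f (q(i := 2 * int v)))"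
  proof (rule sum.reindex_bij_witness[where i = "\<lambda>(q, v). q(i := 2 * int v + 1)"
        and j = "\<lambda>p. (p(i := 1), nat ((p i - 1) div 2))"])
    fix p assume p: "p \<in> odd_cells N P"
    then have pi: "odd (p i)" "0 < p i" "p i < P" using assms unfolding odd_cells_def by auto
    then obtain a where a: "p i = 2 * a + 1" by (auto elim: oddE)
    with pi P have a': "a \<ge> 0" "a < int h" by auto
    show "(case (p(i := 1), nat ((p i - 1) div 2)) of (q, v) \<Rightarrow> q(i := 2 * int v + 1)) = p"
      using a a' by auto
    show "(p(i := 1), nat ((p i - 1) div 2)) \<in> ?B \<times> {..<h}"
      using p a a' assms unfolding odd_cells_def by auto
    show "(case (p(i := 1), nat ((p i - 1) div 2)) of
       (q, v) \<Rightarrow> f (q(i := 2 * int (Suc v))) + f (q(i := 2 * int v)))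
       = f (p(i := p i + 1)) + f (p(i := p i - 1))"
      using a a' by (auto simp: algebra_simps)
  next
    fix b assume b: "b \<in> ?B \<times> {..<h}"
    then obtain q v where qv: "b = (q, v)" "q \<in> odd_cells N P" "q i = 1" "v < h" by auto
    then show "((case b of (q, v) \<Rightarrow> q(i := 2 * int v + 1))(i := 1),
        nat (((case b of (q, v) \<Rightarrow> q(i := 2 * int v + 1)) i - 1) div 2)) = b"
      by auto
    show "(case b of (q, v) \<Rightarrow> q(i := 2 * int v + 1)) \<in> odd_cells N P"
      using qv assms unfolding odd_cells_def by auto
  qed
  also have "\<dots> = (\<Sum>q\<in>?B. \<Sum>v<h. f (q(i := 2 * int (Suc v))) + f (q(i := 2 * int v)))"
    by (simp only: sum.cartesian_product)
  also have "\<dots> = (\<Sum>q\<in>?B. f (q(i := P)) + f (q(i := 0)))"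
    unfolding P by (subst telescope_bit[where f = "\<lambda>v. f (_(i := 2 * int v))"]) simp
  finally show ?thesis .
qed

section \<open>Deck transformations and sums over the fundamental box\<close>

definition shift0 :: "int \<Rightarrow> (nat \<Rightarrow> int) \<Rightarrow> nat \<Rightarrow> int" where
  "shift0 P p = p(0 := p 0 + P)"
definition shift_fibre :: "int \<Rightarrow> nat \<Rightarrow> (nat \<Rightarrow> int) \<Rightarrow> nat \<Rightarrow> int" where
  "shift_fibre P i p = p(2*i+2 := p (2*i+2) + P)"
definition shift_flip :: "int \<Rightarrow> nat \<Rightarrow> (nat \<Rightarrow> int) \<Rightarrow> nat \<Rightarrow> int" where
  "shift_flip P i p = p(2*i+1 := p (2*i+1) + P, 2*i+2 := - p (2*i+2))"

text \<open>Deck transformations of $\mathbb{R}^{2m+1}$ over $S^1 \times K^m$: coordinate 0 is a circle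
  and coordinates $2i+1$, $2i+2$ are base and fibre of the $i$-th Klein bottle.\<close>
definition klein_gens :: "nat \<Rightarrow> int \<Rightarrow> ((nat \<Rightarrow> int) \<Rightarrow> nat \<Rightarrow> int) set" where
  "klein_gens m P = insert (shift0 P) (\<Union>i<m. {shift_fibre P i, shift_flip P i})"

lemma klein_gens_lattice_symmetry:
  assumes "\<gamma> \<in> klein_gens m P" "even P"
  shows "lattice_symmetry \<gamma>"
proof -
  consider "\<gamma> = shift0 P" | i where "\<gamma> = shift_fibre P i" | i where "\<gamma> = shift_flip P i"
    using assms(1) unfolding klein_gens_def by auto
  then show ?thesis
  proof cases
    case 1
    show ?thesis unfolding 1 lattice_symmetry_def shift0_def
      by (rule exI[of _ "\<lambda>_. 1"], rule exI[of _ "\<lambda>j. if j = 0 then P else 0"])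
        (use assms(2) in \<open>auto simp: fun_eq_iff\<close>)
  next
    case (2 i)
    show ?thesis unfolding 2 lattice_symmetry_def shift_fibre_def
      by (rule exI[of _ "\<lambda>_. 1"], rule exI[of _ "\<lambda>j. if j = 2*i+2 then P else 0"])
        (use assms(2) in \<open>auto simp: fun_eq_iff\<close>)
  next
    case (3 i)
    show ?thesis unfolding 3 lattice_symmetry_def shift_flip_def
      by (rule exI[of _ "\<lambda>j. if j = 2*i+2 then -1 else 1"],
          rule exI[of _ "\<lambda>j. if j = 2*i+1 then P else 0"])
        (use assms(2) in \<open>auto simp: fun_eq_iff\<close>)
  qed
qed

text \<open>Stokes modulo 2 on a closed manifold: opposite facets of the box are identified in the
  quotient, so the end terms left by telescoping cancel in pairs.\<close>

lemma sum_odd_cells_cobd: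
  fixes h :: nat
  assumes P: "P = 2 * int h" and N: "N = 2 * m + 1"
    and inv: "\<And>\<gamma> p. \<gamma> \<in> klein_gens m P \<Longrightarrow> g (\<gamma> p) = g p"
  shows "(\<Sum>p\<in>odd_cells N P. cobd N g p) = 0"
proof -
  have "(\<Sum>p\<in>odd_cells N P. cobd N g p)
      = (\<Sum>p\<in>odd_cells N P. \<Sum>i<N. g (p(i := p i + 1)) + g (p(i := p i - 1)))"
  proof (rule sum.cong[OF refl])
    fix p assume "p \<in> odd_cells N P"
    then have "{i. i < N \<and> odd (p i)} = {..<N}" unfolding odd_cells_def by auto
    then show "cobd N g p = (\<Sum>i<N. g (p(i := p i + 1)) + g (p(i := p i - 1)))"
      unfolding cobd_def by simp
  qed
  also have "\<dots> = (\<Sum>i<N. \<Sum>p\<in>odd_cells N P. g (p(i := p i + 1)) + g (p(i := p i - 1)))"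
    by (rule sum.swap)
  also have "\<dots> = (\<Sum>i<N. \<Sum>q | q \<in> odd_cells N P \<and> q i = 1. g (q(i := P)) + g (q(i := 0)))"
    by (intro sum.cong refl sum_odd_cells_direction[OF _ P]) simp
  also have "\<dots> = 0"
  proof (rule sum.neutral, rule ballI)
    fix i assume "i \<in> {..<N}"
    then have "i = 0 \<or> (\<exists>j<m. i = 2*j+1) \<or> (\<exists>j<m. i = 2*j+2)"
      unfolding N by (simp, presburger)
    then consider "i = 0" | j where "j < m" "i = 2*j+1" | j where "j < m" "i = 2*j+2" by blast
    then show "(\<Sum>q | q \<in> odd_cells N P \<and> q i = 1. g (q(i := P)) + g (q(i := 0))) = 0"
    proof cases
      case 1
      have "g (q(i := P)) = g (q(i := 0))" for q
        using inv[of "shift0 P" "q(i := 0)"] 1 by (simp add: klein_gens_def shift0_def)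
      then show ?thesis by simp
    next
      case (3 j)
      have "shift_fibre P j \<in> klein_gens m P" using 3 unfolding klein_gens_def by blast
      then have "g (q(i := P)) = g (q(i := 0))" for q
        using inv[of "shift_fibre P j" "q(i := 0)"] 3 by (simp add: shift_fibre_def)
      then show ?thesis by simp
    next
      case (2 j)
      let ?w = "2*j+2"
      let ?B = "{q. q \<in> odd_cells N P \<and> q i = 1}"
      have w: "?w < N" "?w \<noteq> i" using 2 N by auto
      \<comment> \<open>The gluing of the sides \<open>P\<close> and \<open>0\<close> sends the
        fibre coordinate w to -w, and a fibre shift brings this back into the box as P - w. The
        facets agree only after this involution of the index set.\<close>
      have flip: "g (q(i := P)) = g ((q(?w := P - q ?w))(i := 0))" for q
      proof -
        have "q(i := P) = shift_flip P j (q(i := 0, ?w := - q ?w))"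
          unfolding shift_flip_def 2 by auto
        moreover have "(q(?w := P - q ?w))(i := 0) = shift_fibre P j (q(i := 0, ?w := - q ?w))"
          unfolding shift_fibre_def 2 by auto
        moreover have "shift_flip P j \<in> klein_gens m P" "shift_fibre P j \<in> klein_gens m P"
          using 2 unfolding klein_gens_def by blast+
        ultimately show ?thesis
          using inv by (simp del: fun_upd_apply)
      qed
      have "(\<Sum>q\<in>?B. g (q(i := P))) = (\<Sum>q\<in>?B. g (q(i := 0)))"
      proof (rule sum.reindex_bij_witness[where i = "\<lambda>q. q(?w := P - q ?w)" and j = "\<lambda>q. q(?w := P - q ?w)"])
        fix q assume q: "q \<in> ?B"
        then have "odd (q ?w)" "0 < q ?w" "q ?w < P" using w unfolding odd_cells_def by auto
        then show "q(?w := P - q ?w) \<in> ?B" "q(?w := P - q ?w) \<in> ?B"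
          using q w P unfolding odd_cells_def by auto
        show "g ((q(?w := P - q ?w))(i := 0)) = g (q(i := P))" by (rule flip[symmetric])
      qed (auto simp: fun_eq_iff)
      then show ?thesis by (simp add: sum.distrib)
    qed
  qed
  finally show ?thesis .
qed

section \<open>Exterior products of cochains and their coboundary\<close>

definition cobd1 :: "(int \<Rightarrow> bit) \<Rightarrow> int \<Rightarrow> bit" where
  "cobd1 f t = (if odd t then f (t + 1) + f (t - 1) else 0)"

definition cobd2 :: "(int \<Rightarrow> int \<Rightarrow> bit) \<Rightarrow> int \<Rightarrow> int \<Rightarrow> bit" where
  "cobd2 f x w = (if odd x then f (x + 1) w + f (x - 1) w else 0) +
                 (if odd w then f x (w + 1) + f x (w - 1) else 0)"

definition cross :: "nat \<Rightarrow> (int \<Rightarrow> bit) \<Rightarrow> (nat \<Rightarrow> int \<Rightarrow> int \<Rightarrow> bit) \<Rightarrow> (nat \<Rightarrow> int) \<Rightarrow> bit" where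
  "cross m g G p = g (p 0) * (\<Prod>i<m. G i (p (2*i+1)) (p (2*i+2)))"

lemma sum_lessThan_blocks:
  fixes m :: nat
  shows "(\<Sum>i<2*m+1. F i) = F 0 + (\<Sum>j<m. F (2*j+1) + F (2*j+2) :: bit)"
  by (induction m) (simp_all add: ac_simps)

lemma cross_update:
  assumes "j < m"
  shows "cross m g (G(j := K)) p = K (p (2*j+1)) (p (2*j+2)) * (g (p 0) * (\<Prod>i\<in>{..<m}-{j}. G i (p (2*i+1)) (p (2*i+2))))"
proof -
  have "(\<Prod>i<m. (G(j := K)) i (p (2*i+1)) (p (2*i+2)))
     = K (p (2*j+1)) (p (2*j+2)) * (\<Prod>i\<in>{..<m}-{j}. G i (p (2*i+1)) (p (2*i+2)))"
    using assms by (subst prod.remove[of _ j]) (auto intro!: prod.cong)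
  then show ?thesis unfolding cross_def by (simp add: ac_simps)
qed

lemma cross_at:
  assumes "j < m"
  shows "cross m g G p = G j (p (2*j+1)) (p (2*j+2)) * (g (p 0) * (\<Prod>i\<in>{..<m}-{j}. G i (p (2*i+1)) (p (2*i+2))))"
  using cross_update[OF assms, of g G "G j" p] by simp

text \<open>Leibniz rule for the exterior product over the factors of S^1 x K^m; modulo 2 it carries
  no signs.\<close>

lemma cobd_cross:
  "cobd (2*m+1) (cross m g G) p
     = cross m (cobd1 g) G p + (\<Sum>j<m. cross m g (G(j := cobd2 (G j))) p)"
proof -
  define F where "F i = (if odd (p i) then cross m g G (p(i := p i + 1)) + cross m g G (p(i := p i - 1)) else 0)" for i
  have "cobd (2*m+1) (cross m g G) p = (\<Sum>i<2*m+1. F i)"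
    unfolding cobd_def F_def by (rule sum.mono_neutral_cong_left) auto
  also have "\<dots> = F 0 + (\<Sum>j<m. F (2*j+1) + F (2*j+2))"
    by (rule sum_lessThan_blocks)
  also have "F 0 = cross m (cobd1 g) G p"
    unfolding F_def cross_def cobd1_def by (simp add: distrib_right)
  also have "(\<Sum>j<m. F (2*j+1) + F (2*j+2)) = (\<Sum>j<m. cross m g (G(j := cobd2 (G j))) p)"
  proof (rule sum.cong[OF refl])
    fix j assume "j \<in> {..<m}"
    then have j: "j < m" by simp
    have 1: "cross m g G (p(2*j+1 := a)) = G j a (p (2*j+2)) * (g (p 0) * (\<Prod>i\<in>{..<m}-{j}. G i (p (2*i+1)) (p (2*i+2))))" for a
    proof -
      have "(\<Prod>i\<in>{..<m}-{j}. G i ((p(2*j+1 := a)) (2*i+1)) ((p(2*j+1 := a)) (2*i+2)))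
         = (\<Prod>i\<in>{..<m}-{j}. G i (p (2*i+1)) (p (2*i+2)))"
      proof (rule prod.cong[OF refl])
        fix i assume "i \<in> {..<m} - {j}"
        then have "2*i+1 \<noteq> 2*j+1" "2*i+2 \<noteq> 2*j+1" by (auto, presburger?)
        then show "G i ((p(2*j+1 := a)) (2*i+1)) ((p(2*j+1 := a)) (2*i+2)) = G i (p (2*i+1)) (p (2*i+2))" by simp
      qed
      then show ?thesis unfolding cross_at[OF j] by simp
    qed
    have 2: "cross m g G (p(2*j+2 := a)) = G j (p (2*j+1)) a * (g (p 0) * (\<Prod>i\<in>{..<m}-{j}. G i (p (2*i+1)) (p (2*i+2))))" for a
    proof -
      have "(\<Prod>i\<in>{..<m}-{j}. G i ((p(2*j+2 := a)) (2*i+1)) ((p(2*j+2 := a)) (2*i+2)))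
         = (\<Prod>i\<in>{..<m}-{j}. G i (p (2*i+1)) (p (2*i+2)))"
      proof (rule prod.cong[OF refl])
        fix i assume "i \<in> {..<m} - {j}"
        then have "2*i+1 \<noteq> 2*j+2" "2*i+2 \<noteq> 2*j+2" by (auto, presburger?)
        then show "G i ((p(2*j+2 := a)) (2*i+1)) ((p(2*j+2 := a)) (2*i+2)) = G i (p (2*i+1)) (p (2*i+2))" by simp
      qed
      then show ?thesis unfolding cross_at[OF j] by simp
    qed
    show "F (2*j+1) + F (2*j+2) = cross m g (G(j := cobd2 (G j))) p"
      unfolding F_def 1 2 cross_update[OF j] cobd2_def by (simp add: distrib_right)
  qed
  finally show ?thesis .
qed

text \<open>All factors being closed, only the one that receives \<open>\<nu>\<close> or
  \<open>\<beta>\<close> survives the Leibniz rule. So a step of \<open>cup\<close> for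
  \<open>wall_cochain\<close> acts on such products as multiplication by v + y_j.\<close>

lemma cobd_mult_cross:
  assumes g: "\<And>t. cobd1 g t = 0" and G: "\<And>i x w. i < m \<Longrightarrow> cobd2 (G i) x w = 0" and j: "j < m"
  shows "cobd (2*m+1) (\<lambda>p. (\<nu> (p 0) + \<beta> (p (2*j+1)) (p (2*j+2))) * cross m g G p) q
    = cross m (cobd1 (\<lambda>t. \<nu> t * g t)) G q
      + cross m g (G(j := cobd2 (\<lambda>x w. \<beta> x w * G j x w))) q"
proof -
  define G' where "G' = G(j := \<lambda>x w. \<beta> x w * G j x w)"
  have split: "(\<nu> (p 0) + \<beta> (p (2*j+1)) (p (2*j+2))) * cross m g G p
      = cross m (\<lambda>t. \<nu> t * g t) G p + cross m g G' p" for p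
    unfolding distrib_right G'_def cross_update[OF j] cross_at[OF j] by (simp add: ac_simps)
  have zero: "cross m f (G(i := cobd2 (G i))) q = 0" if "i < m" for i f
    using G[OF that] by (simp add: cross_update[OF that])
  have "cross m g (G'(i := cobd2 (G' i))) q
     = (if i = j then cross m g (G(j := cobd2 (\<lambda>x w. \<beta> x w * G j x w))) q else 0)" if "i < m" for i
  proof (cases "i = j")
    case True
    then show ?thesis unfolding G'_def by simp
  next
    case False
    then show ?thesis using G[OF that] by (simp add: G'_def cross_update[OF that])
  qed
  then have "(\<Sum>i<m. cross m g (G'(i := cobd2 (G' i))) q) = cross m g (G(j := cobd2 (\<lambda>x w. \<beta> x w * G j x w))) q"
    using j by (simp add: sum.delta)
  moreover have "cross m (cobd1 g) G' q = 0"
    using g by (simp add: cross_def)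
  ultimately show ?thesis
    unfolding split cobd_add cobd_cross by (simp add: zero)
qed

section \<open>Explicit representatives of v, y and their products\<close>

definition wall1 :: "int \<Rightarrow> int \<Rightarrow> bit" where
  "wall1 P t = of_bool (odd (t div P))"

text \<open>The function $\lfloor w/P \rfloor$ on $0 \le x < P$, continued by $(x,w) \mapsto (x+P,-w)$.
  Its self-cup-product is a single cell of the fundamental domain.\<close>
definition wall2 :: "int \<Rightarrow> int \<Rightarrow> int \<Rightarrow> bit" where
  "wall2 P x w = of_bool (odd ((if even (x div P) then w else - w) div P))"

text \<open>Represents v + y_j for the block j = (k-1) div 2, counted from 0. As
  \<open>0 - 1 = 0\<close> in nat, the values k = 0, 1, 2 all belong to block 0, while every later
  block gets two: the cube on the first factor and the squares on the others.\<close>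

definition wall_cochain :: "int \<Rightarrow> nat \<Rightarrow> (nat \<Rightarrow> int) \<Rightarrow> bit" where
  "wall_cochain P k p = wall1 P (p 0) + wall2 P (p (2*((k-1) div 2)+1)) (p (2*((k-1) div 2)+2))"

lemma of_bool_odd_add_1_bit: "(of_bool (odd (a + 1)) :: bit) = of_bool (odd a) + 1" for a :: int
  by (cases "even a") auto

lemma of_bool_odd_diff_1_bit: "(of_bool (odd (a - 1)) :: bit) = of_bool (odd a) + 1" for a :: int
  by (cases "even a") auto

lemma wall1_shift: "P > 0 \<Longrightarrow> wall1 P (t + P) = wall1 P t + 1"
  unfolding wall1_def by (simp add: div_add_self2 of_bool_odd_add_1_bit del: of_bool_eq even_add odd_add)

lemma wall2_shift_fibre: "P > 0 \<Longrightarrow> wall2 P x (w + P) = wall2 P x w + 1"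
proof -
  assume "P > 0"
  then have "(w + P) div P = w div P + 1" "(- w - P) div P = - w div P - 1"
    using div_mult_self1[of P "-w" "-1"] by (simp_all add: div_add_self2)
  then show ?thesis
    unfolding wall2_def by (cases "even (x div P)") (auto simp: of_bool_odd_add_1_bit of_bool_odd_diff_1_bit simp del: even_add odd_add even_diff)
qed

lemma wall2_shift_flip: "P > 0 \<Longrightarrow> wall2 P (x + P) (- w) = wall2 P x w"
  unfolding wall2_def by (simp add: div_add_self2)

text \<open>\<open>cell0\<close> and \<open>kcell0\<close> are the units of the two factors;
  \<open>cell1\<close> represents v, \<open>kcell1\<close> represents y and \<open>kcell2\<close>
  represents y^2.\<close>

definition cell0 :: "int \<Rightarrow> bit" where "cell0 t = of_bool (even t)"
definition cell1 :: "int \<Rightarrow> int \<Rightarrow> bit" where "cell1 P = cobd1 (\<lambda>t. wall1 P t * cell0 t)"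
definition kcell0 :: "int \<Rightarrow> int \<Rightarrow> bit" where "kcell0 x w = of_bool (even x \<and> even w)"
definition kcell1 :: "int \<Rightarrow> int \<Rightarrow> int \<Rightarrow> bit" where "kcell1 P = cobd2 (\<lambda>x w. wall2 P x w * kcell0 x w)"
definition kcell2 :: "int \<Rightarrow> int \<Rightarrow> int \<Rightarrow> bit" where "kcell2 P = cobd2 (\<lambda>x w. wall2 P x w * kcell1 P x w)"

lemma cobd1_cell0: "cobd1 cell0 t = 0"
  by (simp add: cobd1_def cell0_def)

lemma cell1_even: "even t \<Longrightarrow> cell1 P t = 0"
  by (simp add: cell1_def cobd1_def)

text \<open>\<open>cell1\<close> lives on edges of a line, so its product with any function vanishes
  on vertices. With \<open>wall1\<close> for \<open>f\<close> the second equation is v^2 =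
  0.\<close>

lemma cobd1_cell1: "cobd1 (cell1 P) t = 0" "cobd1 (\<lambda>t. f t * cell1 P t) t = 0"
  by (simp_all add: cobd1_def[of _ t] cell1_even)

lemma kcell1_support: "even x \<Longrightarrow> even w \<Longrightarrow> kcell1 P x w = 0" "odd x \<Longrightarrow> odd w \<Longrightarrow> kcell1 P x w = 0"
  by (simp_all add: kcell1_def cobd2_def kcell0_def)

lemma cobd2_kcell0: "cobd2 kcell0 x w = 0"
  by (simp add: cobd2_def kcell0_def)

lemma cobd2_cobd2: "cobd2 (cobd2 f) x w = 0"
proof -
  have "a + b + (c + d) + (a + c + (b + d)) = 0" for a b c d :: bit
    by (cases a; cases b; cases c; cases d) simp_all
  then show ?thesis by (simp add: cobd2_def add.commute)
qed

lemma kcell2_support: "even x \<or> even w \<Longrightarrow> kcell2 P x w = 0"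
  by (auto simp add: kcell2_def cobd2_def kcell1_support)

text \<open>\<open>kcell2\<close> has the top degree of the surface; with \<open>wall2\<close> for
  \<open>f\<close> the second equation is y^3 = 0.\<close>

lemma cobd2_kcell2: "cobd2 (kcell2 P) x w = 0" "cobd2 (\<lambda>x w. f x w * kcell2 P x w) x w = 0"
  by (simp_all add: cobd2_def[of _ x w] kcell2_support)

lemma cobd2_kcell1: "cobd2 (kcell1 P) x w = 0"
  by (simp add: kcell1_def cobd2_cobd2)

lemma cup_wall_0: "cup (2*m+1) b 0 p = cross m cell0 (\<lambda>_. kcell0) p"
proof -
  have "(\<forall>i<2*m+1. even (p i)) \<longleftrightarrow> even (p 0) \<and> (\<forall>j<m. even (p (2*j+1)) \<and> even (p (2*j+2)))"
  proof (intro iffI conjI allI impI)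
    fix i assume *: "even (p 0) \<and> (\<forall>j<m. even (p (2*j+1)) \<and> even (p (2*j+2)))" "i < 2*m+1"
    then have "i = 0 \<or> (\<exists>j<m. i = 2*j+1) \<or> (\<exists>j<m. i = 2*j+2)" by presburger
    with * show "even (p i)" by auto
  qed auto
  moreover have "(\<Prod>j<m. kcell0 (p (2*j+1)) (p (2*j+2))) = of_bool (\<forall>j<m. even (p (2*j+1)) \<and> even (p (2*j+2)))"
    by (induction m) (auto simp: kcell0_def less_Suc_eq)
  ultimately show ?thesis by (auto simp: cross_def cell0_def)
qed

lemma cup_Suc_cong:
  assumes "\<And>p. cup N b k p = f p"
  shows "cup N b (Suc k) p = cobd N (\<lambda>p. b k p * f p) p"
  using assms by simp

context
  fixes m :: nat and P :: int
begin

abbreviation "wall_cup \<equiv> cup (2*m+1) (wall_cochain P)"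

text \<open>The Klein factors once \<open>q\<close> blocks are used up: y^2 on the first
  \<open>q\<close>, the unit on the rest.\<close>

definition state :: "nat \<Rightarrow> nat \<Rightarrow> int \<Rightarrow> int \<Rightarrow> bit" where
  "state q i = (if i < q then kcell2 P else kcell0)"

lemma cobd2_state: "cobd2 (state q i) x w = 0"
  by (simp add: state_def cobd2_kcell0 cobd2_kcell2)

text \<open>This is (v + y)^3 = v y^2 in steps: v + y, then v y + v y + y^2 = y^2, then v y^2
  because y^3 = 0. Each identity holds for the cochains, not only up to coboundaries.\<close>

lemma wall_cup_3:
  assumes "0 < m"
  shows "wall_cup 3 p = cross m (cell1 P) (state 1) p"
proof -
  let ?G = "\<lambda>_. kcell0"
  have z: "cross m (\<lambda>t. 0) G p = 0" "cross m g (G(0 := \<lambda>x w. 0)) p = 0"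
    "cross m (cobd1 (\<lambda>t. wall1 P t * cell1 P t)) G p = 0" for g G p
    using cross_update[OF assms, of g G "\<lambda>x w. 0" p] by (simp_all add: cross_def cobd1_cell1)
  have b: "wall_cochain P 0 p = wall1 P (p 0) + wall2 P (p (2*0+1)) (p (2*0+2))"
    "wall_cochain P 1 p = wall1 P (p 0) + wall2 P (p (2*0+1)) (p (2*0+2))"
    "wall_cochain P 2 p = wall1 P (p 0) + wall2 P (p (2*0+1)) (p (2*0+2))" for p
    by (simp_all add: wall_cochain_def)
  note step = cobd_mult_cross[OF _ _ assms, where \<nu> = "wall1 P" and \<beta> = "wall2 P"]
  have zz: "cobd2 (\<lambda>x w. wall2 P x w * kcell2 P x w) = (\<lambda>x w. 0)"
    by (intro ext) (rule cobd2_kcell2)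
  have 1: "wall_cup 1 p = cross m (cell1 P) ?G p + cross m cell0 (?G(0 := kcell1 P)) p" for p
  proof -
    have "wall_cup (Suc 0) p = cross m (cobd1 (\<lambda>t. wall1 P t * cell0 t)) ?G p
       + cross m cell0 (?G(0 := cobd2 (\<lambda>x w. wall2 P x w * kcell0 x w))) p"
      unfolding cup_Suc_cong[OF cup_wall_0] b
      using step[where g = cell0 and G = ?G] by (simp add: cobd1_cell0 cobd2_kcell0)
    then show ?thesis by (simp add: cell1_def kcell1_def)
  qed
  have 2: "wall_cup 2 p = cross m cell0 (?G(0 := kcell2 P)) p" for p
  proof -
    have A: "cobd (2*m+1) (\<lambda>p. (wall1 P (p 0) + wall2 P (p (2*0+1)) (p (2*0+2))) * cross m (cell1 P) ?G p) p
        = cross m (cell1 P) (?G(0 := kcell1 P)) p"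
      by (subst step) (simp_all add: cobd1_cell1 cobd2_kcell0 z kcell1_def)
    have B: "cobd (2*m+1) (\<lambda>p. (wall1 P (p 0) + wall2 P (p (2*0+1)) (p (2*0+2))) * cross m cell0 (?G(0 := kcell1 P)) p) p
        = cross m (cell1 P) (?G(0 := kcell1 P)) p + cross m cell0 (?G(0 := kcell2 P)) p"
      by (subst step) (simp_all add: cobd1_cell0 cobd2_kcell0 cobd2_kcell1 z kcell2_def cell1_def)
    have "wall_cup (Suc 1) p = cross m (cell1 P) (?G(0 := kcell1 P)) p
       + (cross m (cell1 P) (?G(0 := kcell1 P)) p + cross m cell0 (?G(0 := kcell2 P)) p)"
      unfolding cup_Suc_cong[OF 1] b distrib_left cobd_add
      using A B by simp
    then show ?thesis by (simp add: numeral_2_eq_2 del: cup.simps)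
  qed
  have "wall_cup (Suc 2) p = cross m (cell1 P) (?G(0 := kcell2 P)) p"
    unfolding cup_Suc_cong[OF 2] b
    by (subst step) (auto simp: cobd1_cell0 cobd2_kcell0 cobd2_kcell2 z zz cell1_def)
  moreover have "?G(0 := kcell2 P) = state 1"
    by (auto simp: state_def fun_eq_iff)
  ultimately show ?thesis by (simp add: numeral_3_eq_3 numeral_2_eq_2 del: cup.simps)
qed

text \<open>Once v is a factor, v^2 = 0 reduces v + y_j to y_j, so two further steps multiply by
  y_j^2.\<close>

lemma wall_cup_odd:
  assumes "0 < q" "q \<le> m"
  shows "wall_cup (2*q+1) p = cross m (cell1 P) (state q) p"
  using assms
proof (induction q arbitrary: p)
  case (Suc q)
  show ?case
  proof (cases "q = 0")
    case True
    then show ?thesis using wall_cup_3 Suc by (simp add: numeral_3_eq_3 del: cup.simps)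
  next
    case False
    then have q: "q < m" and IH: "\<And>p. wall_cup (2*q+1) p = cross m (cell1 P) (state q) p"
      using Suc by auto
    note step = cobd_mult_cross[OF _ _ q, where \<nu> = "wall1 P" and \<beta> = "wall2 P"]
    have z: "cross m (cobd1 (\<lambda>t. wall1 P t * cell1 P t)) G p = 0" for G p
      by (simp add: cross_def cobd1_cell1)
    have b: "wall_cochain P (2*q+1) p = wall1 P (p 0) + wall2 P (p (2*q+1)) (p (2*q+2))"
      "wall_cochain P (Suc (2*q+1)) p = wall1 P (p 0) + wall2 P (p (2*q+1)) (p (2*q+2))" for p
      by (simp_all add: wall_cochain_def)
    have 1: "wall_cup (Suc (2*q+1)) p = cross m (cell1 P) ((state q)(q := kcell1 P)) p" for p
      unfolding cup_Suc_cong[OF IH] b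
      by (subst step) (simp_all add: cobd1_cell1 cobd2_state z kcell1_def, simp add: state_def)
    have "wall_cup (Suc (Suc (2*q+1))) p = cross m (cell1 P) ((state q)(q := kcell2 P)) p"
      unfolding cup_Suc_cong[OF 1] b
      by (subst step) (auto simp: cobd1_cell1 cobd2_state cobd2_kcell1 z kcell2_def)
    moreover have "(state q)(q := kcell2 P) = state (Suc q)"
      by (auto simp: state_def fun_eq_iff)
    ultimately show ?thesis by (simp del: cup.simps)
  qed
qed simp

end

section \<open>Evaluation on the fundamental box\<close>

lemma wall1_eq: "0 \<le> t \<Longrightarrow> t \<le> P \<Longrightarrow> P > 0 \<Longrightarrow> wall1 P t = of_bool (t = P)"
  by (cases "t = P") (auto simp: wall1_def div_pos_pos_trivial)

lemma wall2_eq_0: "0 \<le> x \<Longrightarrow> x < P \<Longrightarrow> 0 \<le> w \<Longrightarrow> w < P \<Longrightarrow> wall2 P x w = 0"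
  by (simp add: wall2_def div_pos_pos_trivial)

lemma wall2_top: "0 \<le> x \<Longrightarrow> x \<le> P \<Longrightarrow> P > 0 \<Longrightarrow> wall2 P x P = 1"
  by (cases "x = P") (auto simp: wall2_def div_pos_pos_trivial zdiv_zminus1_eq_if)

text \<open>On this side the quotient is \<open>- w div P\<close>, which is -1 for positive
  \<open>w\<close> but 0 for \<open>w = 0\<close>; the jump at the corner (P, 0) is the source of
  y^2.\<close>

lemma wall2_right: "0 \<le> w \<Longrightarrow> w < P \<Longrightarrow> wall2 P P w = of_bool (w > 0)"
  by (auto simp: wall2_def div_pos_pos_trivial zdiv_zminus1_eq_if)

lemma cell1_eq:
  assumes "odd t" "0 < t" "t < P"
  shows "cell1 P t = of_bool (t = P - 1)"
  using assms by (simp add: cell1_def cobd1_def cell0_def wall1_eq)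

text \<open>In the closed box \<open>wall2\<close> is nonzero only on the sides w = P and x = P. It
  is constant on the first and jumps on the second only across the edge centred at w = 1, so only
  the cell next to this edge contributes.\<close>

lemma kcell2_eq:
  assumes "odd x" "0 < x" "x < P" "odd w" "0 < w" "w < P" "even P"
  shows "kcell2 P x w = of_bool (x = P - 1 \<and> w = 1)"
proof -
  have le: "w + 1 \<le> P" "x + 1 \<le> P" using assms by auto
  have left: "wall2 P (x - 1) w = 0" and bottom: "wall2 P x (w - 1) = 0"
    using assms by (auto intro!: wall2_eq_0)
  have top: "wall2 P x (w + 1) * kcell1 P x (w + 1) = 0"
  proof (cases "w + 1 = P")
    case True
    have "kcell1 P x P = 0"
      using assms by (simp add: kcell1_def cobd2_def kcell0_def wall2_top)
    then show ?thesis using True by simp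
  next
    case False
    then show ?thesis using assms le by (simp add: wall2_eq_0)
  qed
  have right: "wall2 P (x + 1) w * kcell1 P (x + 1) w = of_bool (x = P - 1 \<and> w = 1)"
  proof (cases "x + 1 = P")
    case True
    have "w + 1 = P \<Longrightarrow> wall2 P P (w + 1) = 1" using assms wall2_top[of P P] by simp
    moreover have "w + 1 < P \<Longrightarrow> wall2 P P (w + 1) = 1" using assms by (simp add: wall2_right)
    ultimately have "wall2 P P (w + 1) = 1" using le by linarith
    moreover have "wall2 P P (w - 1) = of_bool (w \<noteq> 1)" using assms by (auto simp: wall2_right)
    moreover have "wall2 P P w = 1" using assms by (simp add: wall2_right)
    moreover have "kcell1 P P w = wall2 P P (w + 1) + wall2 P P (w - 1)"
      using assms by (simp add: kcell1_def cobd2_def kcell0_def)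
    ultimately show ?thesis using True by auto
  next
    case False
    then have "wall2 P (x + 1) w = 0" using assms le by (intro wall2_eq_0) auto
    then show ?thesis using False by auto
  qed
  show ?thesis
    using assms left bottom top right unfolding kcell2_def cobd2_def by simp
qed

lemma sum_odd_cells_wall_cup:
  fixes h m :: nat
  assumes "P = 2 * int h" "0 < h" "0 < m" "N = 2*m+1"
  shows "(\<Sum>p\<in>odd_cells N P. cup N (wall_cochain P) N p) = 1"
proof -
  \<comment> \<open>The one cell where every factor is 1: \<open>P - 1\<close> on the circle by
    \<open>cell1_eq\<close>, and (P - 1, 1) on each Klein bottle by
    \<open>kcell2_eq\<close>.\<close>
  define s where "s i = (if N \<le> i then 0 else if i = 0 \<or> odd i then P - 1 else 1)" for i
  have s: "s \<in> odd_cells N P" using assms unfolding odd_cells_def s_def by auto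
  have "cup N (wall_cochain P) N p = of_bool (p = s)" if p: "p \<in> odd_cells N P" for p
  proof -
    have p': "odd (p i)" "0 < p i" "p i < P" if "i < N" for i
      using p that unfolding odd_cells_def by auto
    have "cup N (wall_cochain P) N p = cross m (cell1 P) (state P m) p"
      unfolding assms(4) using wall_cup_odd[of m m P] assms by simp
    also have "\<dots> = of_bool (p 0 = P - 1) * (\<Prod>i<m. of_bool (p (2*i+1) = P - 1 \<and> p (2*i+2) = 1))"
      unfolding cross_def
    proof (rule arg_cong2[where f = "(*)"])
      show "cell1 P (p 0) = of_bool (p 0 = P - 1)" using p'[of 0] assms by (simp add: cell1_eq)
      show "(\<Prod>i<m. state P m i (p (2*i+1)) (p (2*i+2))) = (\<Prod>i<m. of_bool (p (2*i+1) = P - 1 \<and> p (2*i+2) = 1))"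
      proof (rule prod.cong[OF refl])
        fix i assume "i \<in> {..<m}"
        then show "state P m i (p (2*i+1)) (p (2*i+2)) = of_bool (p (2*i+1) = P - 1 \<and> p (2*i+2) = 1)"
          using p'[of "2*i+1"] p'[of "2*i+2"] assms by (simp add: state_def kcell2_eq)
      qed
    qed
    also have "(\<Prod>i<m. of_bool (p (2*i+1) = P - 1 \<and> p (2*i+2) = 1) :: bit)
       = of_bool (\<forall>i<m. p (2*i+1) = P - 1 \<and> p (2*i+2) = 1)"
      by (induction m) (auto simp: less_Suc_eq)
    also have "of_bool (p 0 = P - 1) * \<dots> = (of_bool (p = s) :: bit)"
    proof -
      have "p = s \<longleftrightarrow> p 0 = P - 1 \<and> (\<forall>i<m. p (2*i+1) = P - 1 \<and> p (2*i+2) = 1)"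
      proof (intro iffI ext)
        fix i assume *: "p 0 = P - 1 \<and> (\<forall>i<m. p (2*i+1) = P - 1 \<and> p (2*i+2) = 1)"
        have "N \<le> i \<or> i = 0 \<or> (\<exists>j<m. i = 2*j+1) \<or> (\<exists>j<m. i = 2*j+2)" 
          unfolding assms(4) by presburger
        then show "p i = s i"
          using * p by (auto simp: s_def odd_cells_def assms(4))
      qed (auto simp: s_def assms(4))
      then show ?thesis by simp
    qed
    finally show ?thesis .
  qed
  then have "(\<Sum>p\<in>odd_cells N P. cup N (wall_cochain P) N p) = (\<Sum>p\<in>odd_cells N P. of_bool (p = s))"
    by (rule sum.cong[OF refl])
  also have "\<dots> = (\<Sum>p\<in>odd_cells N P. if p = s then 1 else 0)" by (simp add: of_bool_def)
  also have "\<dots> = 1" using s by (simp add: sum.delta finite_odd_cells)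
  finally show ?thesis .
qed

text \<open>These are the characters of v + y_j; \<open>section_sign_shift\<close> yields the same
  ones, as signs.\<close>

lemma wall_cochain_equivariant:
  assumes "P > 0"
  shows "wall_cochain P k (shift0 P p) = wall_cochain P k p + 1"
    and "wall_cochain P k (shift_fibre P i p) = wall_cochain P k p + of_bool (i = (k-1) div 2)"
    and "wall_cochain P k (shift_flip P i p) = wall_cochain P k p"
proof -
  show "wall_cochain P k (shift0 P p) = wall_cochain P k p + 1"
    unfolding wall_cochain_def shift0_def fun_upd_apply
    using wall1_shift[OF assms, of "p 0"] by (simp add: ac_simps)
  have *: "2*a+1 \<noteq> 2*b+2" for a b :: nat by presburger
  show "wall_cochain P k (shift_fibre P i p) = wall_cochain P k p + of_bool (i = (k-1) div 2)"
    unfolding wall_cochain_def shift_fibre_def fun_upd_apply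
    using wall2_shift_fibre[OF assms] * by (auto simp: add.assoc)
  show "wall_cochain P k (shift_flip P i p) = wall_cochain P k p"
    unfolding wall_cochain_def shift_flip_def fun_upd_apply
    using wall2_shift_flip[OF assms] * by auto
qed

text \<open>The characters of \<open>b\<close> alone fix the sum of \<open>cup N b N\<close> over
  the box, and \<open>wall_cochain\<close> shows it to be 1. On a cell with nonzero value no
  \<open>b k\<close> can be constant, by \<open>cup_eq_0_of_const\<close>.\<close>

lemma odd_cell_nonconstant:
  fixes h m :: nat and b :: "nat \<Rightarrow> (nat \<Rightarrow> int) \<Rightarrow> bit"
  assumes P: "P = 2 * int h" "0 < h" and N: "0 < m" "N = 2*m+1"
    and b0: "\<And>k p. k < N \<Longrightarrow> b k (shift0 P p) = b k p + 1"
    and bf: "\<And>k i p. k < N \<Longrightarrow> i < m \<Longrightarrow> b k (shift_fibre P i p) = b k p + of_bool (i = (k-1) div 2)"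
    and bx: "\<And>k i p. k < N \<Longrightarrow> i < m \<Longrightarrow> b k (shift_flip P i p) = b k p"
  shows "\<exists>p\<in>odd_cells N P. \<forall>k<N. \<forall>c. \<exists>q. (\<forall>i<N. \<bar>q i - p i\<bar> \<le> 1) \<and> (\<forall>i\<ge>N. q i = 0) \<and> b k q \<noteq> c"
proof -
  have pos: "P > 0" using P by simp
  have "\<exists>g. (\<forall>\<gamma>\<in>klein_gens m P. \<forall>p. g (\<gamma> p) = g p) \<and>
      (\<forall>p. cup N b N p = cup N (wall_cochain P) N p + cobd N g p)"
  proof (rule cup_diff_cobd[where K = N])
    show "lattice_symmetry \<gamma>" if "\<gamma> \<in> klein_gens m P" for \<gamma>
      using klein_gens_lattice_symmetry[OF that] P by simp
    show "\<exists>c. \<forall>p. b k (\<gamma> p) = b k p + c \<and> wall_cochain P k (\<gamma> p) = wall_cochain P k p + c"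
      if "\<gamma> \<in> klein_gens m P" "k < N" for \<gamma> k
    proof -
      have "\<gamma> = shift0 P \<or> (\<exists>i<m. \<gamma> = shift_fibre P i) \<or> (\<exists>i<m. \<gamma> = shift_flip P i)"
        using that(1) by (auto simp: klein_gens_def)
      then consider "\<gamma> = shift0 P" | i where "i < m" "\<gamma> = shift_fibre P i" | i where "i < m" "\<gamma> = shift_flip P i"
        by blast
      then show ?thesis
      proof cases
        case 1
        then show ?thesis using b0 wall_cochain_equivariant(1)[OF pos] that by auto
      next
        case (2 i)
        then show ?thesis using bf wall_cochain_equivariant(2)[OF pos] that by blast
      next
        case (3 i)
        then show ?thesis using bx[OF that(2)] wall_cochain_equivariant(3)[OF pos]
          by (intro exI[of _ 0]) simp
      qed
    qed
  qed simp
  then obtain g where g: "\<And>\<gamma> p. \<gamma> \<in> klein_gens m P \<Longrightarrow> g (\<gamma> p) = g p"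
    and eq: "\<And>p. cup N b N p = cup N (wall_cochain P) N p + cobd N g p" by auto
  have "(\<Sum>p\<in>odd_cells N P. cup N b N p) = 1"
    unfolding eq sum.distrib
    using sum_odd_cells_wall_cup[OF P N] sum_odd_cells_cobd[where g = g, OF P(1) N(2)] g by simp
  then have "\<exists>p\<in>odd_cells N P. cup N b N p \<noteq> 0"
    by (metis sum.neutral zero_neq_one)
  then obtain p where p: "p \<in> odd_cells N P" "cup N b N p \<noteq> 0" by blast
  have "\<exists>q. (\<forall>i<N. \<bar>q i - p i\<bar> \<le> 1) \<and> (\<forall>i\<ge>N. q i = 0) \<and> b k q \<noteq> c" if k: "k < N" for k c
  proof (rule ccontr)
    assume "\<not> ?thesis"
    then have const: "b k q = c" if "\<And>i. i < N \<Longrightarrow> \<bar>q i - p i\<bar> \<le> 1" "\<And>i. N \<le> i \<Longrightarrow> q i = p i" for q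
      using that p(1) unfolding odd_cells_def by auto
    have "cup N b N p = 0"
    proof (rule cup_eq_0_of_const)
      show "k < N" by (rule k)
      show "b k q = c" if "\<And>i. i < N \<Longrightarrow> \<bar>q i - p i\<bar> \<le> 1" "\<And>i. N \<le> i \<Longrightarrow> q i = p i" for q
        using const that by blast
    qed (use p(1) in \<open>auto simp: odd_cells_def\<close>)
    with p(2) show False by simp
  qed
  with p(1) show ?thesis by blast
qed

section \<open>The orbit space\<close>

abbreviation torus :: "(complex \<times> complex) set" where
  "torus \<equiv> sphere 0 1 \<times> sphere 0 1"

abbreviation klein :: "(complex \<times> complex) set topology" where
  "klein \<equiv> orbit_space Sigma1_ant Z2_ant"

lemma topspace_Sigma1: "topspace Sigma1_ant = torus"
  by (simp add: Sigma1_ant_def)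

lemma sigma_ant_sigma_ant [simp]: "sigma_ant (sigma_ant x) = x"
  by (simp add: sigma_ant_def)

lemma sigma_ant_torus [simp]: "sigma_ant x \<in> torus \<longleftrightarrow> x \<in> torus"
  by (cases x) (simp add: sigma_ant_def)

lemma orb_Z2: "orb Z2_ant x = {x, sigma_ant x}"
  by (auto simp: orb_def Z2_ant_def)

lemma orb_eq_iff: "orb Z2_ant x = orb Z2_ant y \<longleftrightarrow> x = y \<or> x = sigma_ant y"
  unfolding orb_Z2 by (auto simp: doubleton_eq_iff)

lemma orb_eq_of_mem: "y \<in> orb Z2_ant x \<Longrightarrow> orb Z2_ant y = orb Z2_ant x"
  unfolding orb_eq_iff by (auto simp: orb_Z2)

lemma Union_orbits_Int:
  assumes "U \<subseteq> orb Z2_ant ` A" "V \<subseteq> orb Z2_ant ` B"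
  shows "\<Union>(U \<inter> V) = \<Union>U \<inter> \<Union>V"
proof -
  have "Y = Y'" if *: "x \<in> Y" "Y \<in> U" "x \<in> Y'" "Y' \<in> V" for x Y Y'
  proof -
    have "Y \<in> orb Z2_ant ` A" "Y' \<in> orb Z2_ant ` B" using * assms by auto
    then obtain y y' where "Y = orb Z2_ant y" "Y' = orb Z2_ant y'" by blast
    then show ?thesis using * orb_eq_of_mem by metis
  qed
  then show ?thesis by blast
qed

text \<open>\<open>topology\<close> is inverse to \<open>openin\<close> only on predicates
  satisfying \<open>istopology\<close>; the intersection axiom holds because orbits are equal or
  disjoint.\<close>

lemma openin_klein: "openin klein U \<longleftrightarrow> U \<subseteq> orb Z2_ant ` torus \<and> openin Sigma1_ant (\<Union>U)"
proof -
  have "istopology (\<lambda>U. U \<subseteq> orb Z2_ant ` topspace Sigma1_ant \<and> openin Sigma1_ant (\<Union>U))"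
    unfolding istopology_def
  proof (intro conjI allI impI)
    fix U V assume U: "U \<subseteq> orb Z2_ant ` topspace Sigma1_ant \<and> openin Sigma1_ant (\<Union>U)"
      and V: "V \<subseteq> orb Z2_ant ` topspace Sigma1_ant \<and> openin Sigma1_ant (\<Union>V)"
    show "U \<inter> V \<subseteq> orb Z2_ant ` topspace Sigma1_ant" using U by blast
    show "openin Sigma1_ant (\<Union>(U \<inter> V))"
      using U V Union_orbits_Int[of U _ V] by (metis openin_Int)
  next
    fix \<U> assume \<U>: "\<forall>U\<in>\<U>. U \<subseteq> orb Z2_ant ` topspace Sigma1_ant \<and> openin Sigma1_ant (\<Union>U)"
    then show "\<Union>\<U> \<subseteq> orb Z2_ant ` topspace Sigma1_ant" by blast
    have "\<Union>(\<Union>\<U>) = (\<Union>U\<in>\<U>. \<Union>U)" by blast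
    then show "openin Sigma1_ant (\<Union>(\<Union>\<U>))" using \<U> by auto
  qed
  then show ?thesis
    by (simp add: orbit_space_def topology_inverse' topspace_Sigma1)
qed

lemma openin_Sigma1_sigma_image:
  assumes "openin Sigma1_ant V"
  shows "openin Sigma1_ant (sigma_ant ` V)"
proof -
  have "continuous_map Sigma1_ant Sigma1_ant sigma_ant"
    unfolding Sigma1_ant_def
    by (auto simp: sigma_ant_def[abs_def] intro!: continuous_intros)
  then have "openin Sigma1_ant {x \<in> topspace Sigma1_ant. sigma_ant x \<in> V}"
    using assms by (rule openin_continuous_map_preimage)
  moreover have "{x \<in> topspace Sigma1_ant. sigma_ant x \<in> V} = sigma_ant ` V"
  proof -
    have "V \<subseteq> torus" using openin_subset[OF assms] by (simp add: topspace_Sigma1)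
    moreover have "x \<in> sigma_ant ` V \<longleftrightarrow> sigma_ant x \<in> V" for x
      by (metis image_iff sigma_ant_sigma_ant)
    moreover have "x \<in> torus" if "sigma_ant x \<in> V" for x
      using that \<open>V \<subseteq> torus\<close> sigma_ant_torus[of x] by blast
    ultimately show ?thesis unfolding topspace_Sigma1 by blast
  qed
  ultimately show ?thesis by simp
qed

lemma Union_orb_image: "\<Union>(orb Z2_ant ` V) = V \<union> sigma_ant ` V"
  by (auto simp: orb_Z2)

lemma openin_klein_orb_image:
  assumes "openin Sigma1_ant V"
  shows "openin klein (orb Z2_ant ` V)"
  unfolding openin_klein Union_orb_image
  using assms openin_Sigma1_sigma_image[OF assms] openin_subset[OF assms]
  by (auto simp: topspace_Sigma1 openin_Un)

lemma topspace_klein: "topspace klein = orb Z2_ant ` torus"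
proof
  show "topspace klein \<subseteq> orb Z2_ant ` torus"
    using openin_klein[of "topspace klein"] by simp
  show "orb Z2_ant ` torus \<subseteq> topspace klein"
    using openin_subset[OF openin_klein_orb_image, of torus] openin_topspace[of Sigma1_ant]
    by (simp add: topspace_Sigma1)
qed

lemma continuous_map_orb: "continuous_map Sigma1_ant klein (orb Z2_ant)"
  unfolding continuous_map_def
proof (intro conjI allI impI)
  show "orb Z2_ant \<in> topspace Sigma1_ant \<rightarrow> topspace klein"
    by (auto simp: topspace_klein topspace_Sigma1)
  fix U assume U: "openin klein U"
  have "{x \<in> topspace Sigma1_ant. orb Z2_ant x \<in> U} = \<Union>U"
  proof (intro set_eqI iffI)
    fix x assume "x \<in> {x \<in> topspace Sigma1_ant. orb Z2_ant x \<in> U}"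
    then show "x \<in> \<Union>U" by (auto simp: orb_Z2)
  next
    fix x assume "x \<in> \<Union>U"
    then obtain Y y where "x \<in> Y" "Y \<in> U" "Y = orb Z2_ant y" "x \<in> topspace Sigma1_ant"
      using U openin_subset unfolding openin_klein by blast
    then show "x \<in> {x \<in> topspace Sigma1_ant. orb Z2_ant x \<in> U}"
      using orb_eq_of_mem by auto
  qed
  then show "openin Sigma1_ant {x \<in> topspace Sigma1_ant. orb Z2_ant x \<in> U}"
    using U by (simp add: openin_klein)
qed

text \<open>A product of quotient maps need not be a quotient map, but the orbit map is open, and
  openness passes to products.\<close>

lemma quotient_map_id_orb:
  "quotient_map (top_of_set (torus \<times> torus)) (prod_topology Sigma1_ant klein) (\<lambda>(x, y). (x, orb Z2_ant y))"
proof -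
  have eq: "top_of_set (torus \<times> torus) = prod_topology Sigma1_ant Sigma1_ant"
    by (simp add: Sigma1_ant_def)
  have "open_map (prod_topology Sigma1_ant Sigma1_ant) (prod_topology Sigma1_ant klein) (\<lambda>(x, y). (x, orb Z2_ant y))"
    unfolding open_map_def
  proof (intro allI impI)
    fix W assume W: "openin (prod_topology Sigma1_ant Sigma1_ant) W"
    show "openin (prod_topology Sigma1_ant klein) ((\<lambda>(x, y). (x, orb Z2_ant y)) ` W)"
      unfolding openin_prod_topology_alt
    proof (intro allI impI)
      fix x Y assume "(x, Y) \<in> (\<lambda>(x, y). (x, orb Z2_ant y)) ` W"
      then obtain y where y: "(x, y) \<in> W" "Y = orb Z2_ant y" by auto
      then obtain A B where AB: "openin Sigma1_ant A" "openin Sigma1_ant B" "x \<in> A" "y \<in> B" "A \<times> B \<subseteq> W"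
        using W unfolding openin_prod_topology_alt by meson
      then show "\<exists>U V. openin Sigma1_ant U \<and> openin klein V \<and> x \<in> U \<and> Y \<in> V \<and> U \<times> V \<subseteq> (\<lambda>(x, y). (x, orb Z2_ant y)) ` W"
        using y by (intro exI[of _ A] exI[of _ "orb Z2_ant ` B"]) (auto intro: openin_klein_orb_image)
    qed
  qed
  moreover have "continuous_map (prod_topology Sigma1_ant Sigma1_ant) (prod_topology Sigma1_ant klein) (\<lambda>(x, y). (x, orb Z2_ant y))"
    unfolding continuous_map_pairwise o_def case_prod_unfold
    using continuous_map_compose[OF continuous_map_snd continuous_map_orb]
    by (auto simp: o_def intro: continuous_map_fst)
  moreover have "(\<lambda>(x, y). (x, orb Z2_ant y)) ` topspace (prod_topology Sigma1_ant Sigma1_ant)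
      = topspace (prod_topology Sigma1_ant klein)"
    by (force simp: topspace_klein topspace_Sigma1 simp del: mem_Times_iff)
  ultimately show ?thesis
    unfolding eq by (intro continuous_open_imp_quotient_map)
qed

text \<open>Continuity is tested upstairs, on the full preimage \<open>O'\<close> of an open set,
  over which the restricted map is still a quotient map.\<close>

lemma continuous_map_from_id_orb:
  fixes f :: "(complex \<times> complex) \<times> (complex \<times> complex) \<Rightarrow> 'z::topological_space"
  assumes V: "openin (prod_topology Sigma1_ant klein) V"
    and O: "{(x, y) \<in> torus \<times> torus. (x, orb Z2_ant y) \<in> V} = O'"
    and f: "continuous_on O' f"
    and g: "\<And>x y. (x, y) \<in> O' \<Longrightarrow> g (x, orb Z2_ant y) = f (x, y)"
  shows "continuous_map (subtopology (prod_topology Sigma1_ant klein) V) euclidean g"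
proof (rule continuous_compose_quotient_map)
  have "{z \<in> topspace (top_of_set (torus \<times> torus)). (\<lambda>(x, y). (x, orb Z2_ant y)) z \<in> V} = O'"
    unfolding O[symmetric] by auto
  from quotient_map_restriction[OF quotient_map_id_orb this] V
  show "quotient_map (subtopology (top_of_set (torus \<times> torus)) O') (subtopology (prod_topology Sigma1_ant klein) V) (\<lambda>(x, y). (x, orb Z2_ant y))"
    by blast
  have "O' \<subseteq> torus \<times> torus" using O by auto
  then have "subtopology (top_of_set (torus \<times> torus)) O' = top_of_set O'"
    by (simp add: subtopology_subtopology Int_absorb1)
  moreover have "continuous_on O' (g \<circ> (\<lambda>(x, y). (x, orb Z2_ant y)))"
    using f by (rule continuous_on_eq) (auto simp: g)
  ultimately show "continuous_map (subtopology (top_of_set (torus \<times> torus)) O') euclidean (g \<circ> (\<lambda>(x, y). (x, orb Z2_ant y)))"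
    by simp
qed

text \<open>An arbitrary choice with no continuity. It occurs only in expressions invariant under
  \<open>sigma_ant\<close>, whose continuity follows from
  \<open>continuous_map_from_id_orb\<close>.\<close>

definition rep :: "(complex \<times> complex) set \<Rightarrow> complex \<times> complex" where
  "rep Y = (SOME y. y \<in> Y)"

lemma rep_orb: "rep (orb Z2_ant y) = y \<or> rep (orb Z2_ant y) = sigma_ant y"
  using someI[of "\<lambda>z. z \<in> orb Z2_ant y" y] unfolding rep_def by (auto simp: orb_Z2)

definition level_base :: "(complex \<times> complex) \<times> (complex \<times> complex) set \<Rightarrow> real" where
  "level_base z = Re ((fst (rep (snd z)) / fst (fst z))\<^sup>2)"

definition level_fibre :: "(complex \<times> complex) set \<Rightarrow> real" where
  "level_fibre Y = Re (snd (rep Y))"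

lemma level_base_orb: "level_base (x, orb Z2_ant y) = Re ((fst y / fst x)\<^sup>2)"
  using rep_orb[of y] by (auto simp: level_base_def sigma_ant_def)

lemma level_fibre_orb: "level_fibre (orb Z2_ant y) = Re (snd y)"
  using rep_orb[of y] by (auto simp: level_fibre_def sigma_ant_def)

lemma continuous_map_level_base: "continuous_map (prod_topology Sigma1_ant klein) euclideanreal level_base"
proof -
  have "continuous_map (subtopology (prod_topology Sigma1_ant klein) (topspace (prod_topology Sigma1_ant klein))) euclidean level_base"
  proof (rule continuous_map_from_id_orb, rule openin_topspace)
    show "continuous_on (torus \<times> torus) (\<lambda>z. Re ((fst (snd z) / fst (fst z))\<^sup>2))"
      by (intro continuous_intros) auto
  qed (auto simp: level_base_orb topspace_Sigma1 topspace_klein)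
  then show ?thesis by (simp only: subtopology_topspace)
qed

lemma continuous_map_level_fibre: "continuous_map (prod_topology Sigma1_ant klein) euclideanreal (\<lambda>z. level_fibre (snd z))"
proof -
  have "continuous_map (subtopology (prod_topology Sigma1_ant klein) (topspace (prod_topology Sigma1_ant klein))) euclidean (\<lambda>z. level_fibre (snd z))"
  proof (rule continuous_map_from_id_orb, rule openin_topspace)
    show "continuous_on (torus \<times> torus) (\<lambda>z. Re (snd (snd z)))"
      by (intro continuous_intros)
  qed (auto simp: level_fibre_orb topspace_Sigma1 topspace_klein)
  then show ?thesis by (simp only: subtopology_topspace)
qed

section \<open>A cover by 2n open sets with sections\<close>

definition angle :: "bool \<Rightarrow> complex \<Rightarrow> real" where
  "angle s z = (if s then Arg z else Arg (- z) + pi)"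

lemma cis_angle: "norm z = 1 \<Longrightarrow> cis (angle s z) = z"
  using cis_Arg[of z] cis_Arg[of "-z"]
  by (cases "z = 0") (auto simp: angle_def sgn_eq cis_mult[symmetric])

lemma unit_notin_nonpos_Reals:
  assumes "norm z = 1" "Re z > -1"
  shows "z \<notin> \<real>\<^sub>\<le>\<^sub>0"
proof
  assume "z \<in> \<real>\<^sub>\<le>\<^sub>0"
  then have "Im z = 0" "Re z \<le> 0" by (auto simp: complex_nonpos_Reals_iff)
  with assms(1) have "\<bar>Re z\<bar> = 1" by (simp add: cmod_eq_Re)
  with assms(2) \<open>Re z \<le> 0\<close> show False by simp
qed

text \<open>\<open>Arg\<close> is cut along the nonpositive reals, which meet the unit circle at -1;
  negating the argument moves the cut to 1.\<close>

lemma continuous_on_angle: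
  assumes "continuous_on A f" "\<And>x. x \<in> A \<Longrightarrow> norm (f x) = 1"
    "\<And>x. x \<in> A \<Longrightarrow> if s then Re (f x) > -1 else Re (f x) < 1"
  shows "continuous_on A (\<lambda>x. angle s (f x))"
proof -
  have 1: "f x \<notin> \<real>\<^sub>\<le>\<^sub>0" if "x \<in> A" "s" for x
    using assms(2,3)[OF that(1)] that(2) by (intro unit_notin_nonpos_Reals) auto
  have 2: "- f x \<notin> \<real>\<^sub>\<le>\<^sub>0" if "x \<in> A" "\<not> s" for x
    using assms(2,3)[OF that(1)] that(2) by (intro unit_notin_nonpos_Reals) auto
  show ?thesis
    unfolding angle_def
    by (cases s) (auto intro!: continuous_intros assms(1) dest: 1 2)
qed

definition sheet :: "bool \<Rightarrow> complex \<Rightarrow> real" where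
  "sheet s q = sgn (if s then Re q else Im q)"

text \<open>For \<open>d = 1\<close> this is \<open>z\<close>, for \<open>d = -1\<close> its
  conjugate; the real factor makes joint continuity in \<open>d\<close> and \<open>z\<close>
  immediate.\<close>

definition fibre_lift :: "real \<Rightarrow> complex \<Rightarrow> complex" where
  "fibre_lift d z = Complex (Re z) (d * Im z)"

text \<open>The sign $d$ selects the lift of the orbit of $y$, namely $y$ or $\sigma(y)$, whose first
  coordinate is within a quarter turn of $x$ or, if not $s_1$, in the half turn ahead of $x$.\<close>
definition displacement ::
    "bool \<Rightarrow> bool \<Rightarrow> bool \<Rightarrow> (complex \<times> complex) \<times> (complex \<times> complex) \<Rightarrow> real \<times> real" where
  "displacement s0 s1 s2 = (\<lambda>(x, y). let q = fst y / fst x; d = sheet s1 q in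
     (angle s1 (of_real d * q), angle s2 (fibre_lift d (snd y)) - angle s0 (snd x)))"

text \<open>\<open>sigma_ant\<close> negates \<open>q\<close> and the imaginary part of
  \<open>snd y\<close>, hence also \<open>d\<close>, so the products of \<open>d\<close> with both
  are unchanged.\<close>

lemma displacement_sigma: "displacement s0 s1 s2 (x, sigma_ant y) = displacement s0 s1 s2 (x, y)"
  by (cases s1) (auto simp: displacement_def Let_def sheet_def fibre_lift_def sigma_ant_def sgn_minus)

definition branch_domain ::
    "bool \<Rightarrow> bool \<Rightarrow> bool \<Rightarrow> ((complex \<times> complex) \<times> (complex \<times> complex) set) set" where
  "branch_domain s0 s1 s2 = {z \<in> topspace (prod_topology Sigma1_ant klein).
      (if s0 then Re (snd (fst z)) > -1 else Re (snd (fst z)) < 1) \<and>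
      (if s1 then level_base z > -1 else level_base z < 1) \<and>
      (if s2 then level_fibre (snd z) > -1 else level_fibre (snd z) < 1)}"

lemma openin_halfline:
  assumes "continuous_map X euclideanreal f"
  shows "openin X {x \<in> topspace X. if s then f x > c else f x < d}"
proof -
  have "openin X {x \<in> topspace X. f x \<in> (if s then {c<..} else {..<d})}"
    by (rule openin_continuous_map_preimage[OF assms]) auto
  then show ?thesis by (cases s) simp_all
qed

lemma continuous_map_Re_snd: "continuous_map Sigma1_ant euclideanreal (\<lambda>x. Re (snd x))"
  unfolding Sigma1_ant_def by (auto intro!: continuous_intros)

lemma openin_branch_domain: "openin (prod_topology Sigma1_ant klein) (branch_domain s0 s1 s2)"
proof -
  have "continuous_map (prod_topology Sigma1_ant klein) euclideanreal (\<lambda>z. Re (snd (fst z)))"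
    using continuous_map_compose[OF continuous_map_fst continuous_map_Re_snd] by (simp add: o_def)
  then have "openin (prod_topology Sigma1_ant klein)
     ({z \<in> topspace (prod_topology Sigma1_ant klein). if s0 then Re (snd (fst z)) > -1 else Re (snd (fst z)) < 1} \<inter>
     ({z \<in> topspace (prod_topology Sigma1_ant klein). if s1 then level_base z > -1 else level_base z < 1} \<inter>
      {z \<in> topspace (prod_topology Sigma1_ant klein). if s2 then level_fibre (snd z) > -1 else level_fibre (snd z) < 1}))"
    by (intro openin_Int openin_halfline continuous_map_level_base continuous_map_level_fibre)
  then show ?thesis unfolding branch_domain_def by (rule back_subst) auto
qed

text \<open>On the unit circle Re(q^2) = 2 (Re q)^2 - 1 = 1 - 2 (Im q)^2. The bound on q^2 thus
  keeps the relevant part of \<open>q\<close> nonzero, and multiplying by its sign makes that part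
  positive, so the product misses -1 or 1 respectively.\<close>

lemma sheet_cases:
  assumes "norm q = 1" "if s then Re (q\<^sup>2) > -1 else Re (q\<^sup>2) < 1"
  shows "(if s then Re q else Im q) \<noteq> 0" "sheet s q = 1 \<or> sheet s q = -1"
    "if s then Re (of_real (sheet s q) * q) > -1 else Re (of_real (sheet s q) * q) < 1"
proof -
  have "(cmod q)\<^sup>2 = (Re q)\<^sup>2 + (Im q)\<^sup>2" by (rule cmod_power2)
  with assms(1) have q: "(Re q)\<^sup>2 + (Im q)\<^sup>2 = 1" by simp
  have sq: "Re (q\<^sup>2) = (Re q)\<^sup>2 - (Im q)\<^sup>2" by (simp add: power2_eq_square)
  have ne: "(if s then Re q else Im q) \<noteq> 0"
    using assms(2) q sq by (cases s) auto
  then show "(if s then Re q else Im q) \<noteq> 0" "sheet s q = 1 \<or> sheet s q = -1"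
    by (auto simp: sheet_def sgn_if)
  show "if s then Re (of_real (sheet s q) * q) > -1 else Re (of_real (sheet s q) * q) < 1"
  proof (cases s)
    case True
    then show ?thesis using ne by (auto simp: sheet_def sgn_if)
  next
    case False
    with ne have "(Im q)\<^sup>2 > 0" by simp
    with q have "(Re q)\<^sup>2 < 1" by linarith
    then have "\<bar>Re q\<bar>\<^sup>2 < 1\<^sup>2" by simp
    then have "\<bar>Re q\<bar> < 1" using power2_less_imp_less[of "\<bar>Re q\<bar>" 1] by simp
    then show ?thesis using False by (auto simp: sheet_def sgn_if)
  qed
qed

lemma norm_fibre_lift: "d = 1 \<or> d = -1 \<Longrightarrow> norm (fibre_lift d z) = norm z"
  by (auto simp: fibre_lift_def cmod_def)

lemma branch_domain_orb:
  "(x, orb Z2_ant y) \<in> branch_domain s0 s1 s2 \<and> (x, y) \<in> torus \<times> torus \<longleftrightarrow>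
    (x, y) \<in> torus \<times> torus \<and> (if s0 then Re (snd x) > -1 else Re (snd x) < 1) \<and>
      (if s1 then Re ((fst y / fst x)\<^sup>2) > -1 else Re ((fst y / fst x)\<^sup>2) < 1) \<and>
      (if s2 then Re (snd y) > -1 else Re (snd y) < 1)"
  by (auto simp: branch_domain_def level_base_orb level_fibre_orb topspace_Sigma1 topspace_klein)

lemma continuous_map_displacement:
  "continuous_map (subtopology (prod_topology Sigma1_ant klein) (branch_domain s0 s1 s2)) euclidean
     (\<lambda>z. displacement s0 s1 s2 (fst z, rep (snd z)))"
proof (rule continuous_map_from_id_orb)
  show "openin (prod_topology Sigma1_ant klein) (branch_domain s0 s1 s2)"
    by (rule openin_branch_domain)
  define D where "D = {(x, y) \<in> torus \<times> torus. (x, orb Z2_ant y) \<in> branch_domain s0 s1 s2}"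
  then show "{(x, y) \<in> torus \<times> torus. (x, orb Z2_ant y) \<in> branch_domain s0 s1 s2} = D" by simp
  show "displacement s0 s1 s2 (fst (x, orb Z2_ant y), rep (snd (x, orb Z2_ant y))) = displacement s0 s1 s2 (x, y)"
    if "(x, y) \<in> D" for x y
    using rep_orb[of y] by (auto simp: displacement_sigma)
  have D: "z \<in> D \<Longrightarrow> norm (fst (fst z)) = 1 \<and> norm (snd (fst z)) = 1 \<and> norm (fst (snd z)) = 1 \<and> norm (snd (snd z)) = 1 \<and>
      (if s0 then Re (snd (fst z)) > -1 else Re (snd (fst z)) < 1) \<and>
      (if s1 then Re ((fst (snd z) / fst (fst z))\<^sup>2) > -1 else Re ((fst (snd z) / fst (fst z))\<^sup>2) < 1) \<and>
      (if s2 then Re (snd (snd z)) > -1 else Re (snd (snd z)) < 1)" for z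
  proof -
    assume "z \<in> D"
    then have "(fst z, orb Z2_ant (snd z)) \<in> branch_domain s0 s1 s2 \<and> (fst z, snd z) \<in> torus \<times> torus"
      by (cases z) (simp add: D_def)
    then show ?thesis
      unfolding branch_domain_orb by (simp only: mem_Times_iff fst_conv snd_conv mem_sphere_0) blast
  qed
  define q where "q z = fst (snd z) / fst (fst z)" for z :: "(complex \<times> complex) \<times> (complex \<times> complex)"
  have q: "norm (q z) = 1" "if s1 then Re ((q z)\<^sup>2) > -1 else Re ((q z)\<^sup>2) < 1" if "z \<in> D" for z
    using D[OF that] by (auto simp: q_def norm_divide)
  have cq: "continuous_on D q" unfolding q_def by (intro continuous_intros ballI) (use D in fastforce)
  have cd: "continuous_on D (\<lambda>z. sheet s1 (q z))"
  proof (cases s1)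
    case True
    then show ?thesis
      using sheet_cases(1)[OF q] unfolding sheet_def by (auto intro!: continuous_intros cq)
  next
    case False
    then show ?thesis
      using sheet_cases(1)[OF q] unfolding sheet_def by (auto intro!: continuous_intros cq)
  qed
  have "continuous_on D (\<lambda>z. (angle s1 (of_real (sheet s1 (q z)) * q z),
      angle s2 (fibre_lift (sheet s1 (q z)) (snd (snd z))) - angle s0 (snd (fst z))))"
  proof (intro continuous_on_Pair continuous_on_diff continuous_on_angle)
    show "continuous_on D (\<lambda>z. of_real (sheet s1 (q z)) * q z)" by (intro continuous_intros cd cq)
    show "continuous_on D (\<lambda>z. fibre_lift (sheet s1 (q z)) (snd (snd z)))"
      unfolding fibre_lift_def by (intro continuous_intros cd)
    show "continuous_on D (\<lambda>z. snd (fst z))" by (intro continuous_intros)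
    fix z assume z: "z \<in> D"
    note dz = sheet_cases(2,3)[OF q[OF z]]
    show "norm (of_real (sheet s1 (q z)) * q z) = 1" using dz(1) q(1)[OF z] by (auto simp: norm_mult)
    show "norm (fibre_lift (sheet s1 (q z)) (snd (snd z))) = 1"
      using norm_fibre_lift[OF dz(1)] D[OF z] by simp
    show "norm (snd (fst z)) = 1" using D[OF z] by simp
    show "if s1 then - 1 < Re (of_real (sheet s1 (q z)) * q z) else Re (of_real (sheet s1 (q z)) * q z) < 1"
      using dz(2) .
    show "if s2 then - 1 < Re (fibre_lift (sheet s1 (q z)) (snd (snd z))) else Re (fibre_lift (sheet s1 (q z)) (snd (snd z))) < 1"
      using D[OF z] by (simp add: fibre_lift_def)
    show "if s0 then - 1 < Re (snd (fst z)) else Re (snd (fst z)) < 1" using D[OF z] by simp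
  qed
  then show "continuous_on D (displacement s0 s1 s2)"
    unfolding displacement_def q_def by (simp add: case_prod_unfold Let_def)
qed

section \<open>Paths with a prescribed displacement\<close>

definition flow :: "complex \<times> complex \<Rightarrow> real \<Rightarrow> real \<times> real \<Rightarrow> complex \<times> complex" where
  "flow x t v = (fst x * cis (t * fst v), snd x * cis (t * snd v))"

lemma flow_0: "flow x 0 v = x"
  by (simp add: flow_def)

text \<open>At time 1 the flow reaches \<open>(of_real d * fst y, fibre_lift d (snd y))\<close>,
  which is \<open>y\<close> for \<open>d = 1\<close> and \<open>sigma_ant y\<close> for
  \<open>d = -1\<close>.\<close>

lemma orb_flow_displacement:
  assumes "(x, Y) \<in> branch_domain s0 s1 s2"
  shows "orb Z2_ant (flow x 1 (displacement s0 s1 s2 (x, rep Y))) = Y"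
proof -
  obtain y where y: "y \<in> torus" "Y = orb Z2_ant y" and x: "x \<in> torus"
    using assms by (auto simp: branch_domain_def topspace_klein topspace_Sigma1)
  with assms have c: "if s1 then Re ((fst y / fst x)\<^sup>2) > -1 else Re ((fst y / fst x)\<^sup>2) < 1"
    using branch_domain_orb by blast
  define q where "q = fst y / fst x"
  have q: "norm q = 1" "fst x * q = fst y" using x y by (auto simp: q_def norm_divide)
  note dz = sheet_cases(2)[OF q(1) c[folded q_def]]
  define d where "d = sheet s1 q"
  have "displacement s0 s1 s2 (x, rep Y) = displacement s0 s1 s2 (x, y)"
    using rep_orb[of y] y(2) by (auto simp: displacement_sigma)
  then have D: "displacement s0 s1 s2 (x, rep Y) =
      (angle s1 (of_real d * q), angle s2 (fibre_lift d (snd y)) - angle s0 (snd x))"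
    by (simp add: displacement_def Let_def q_def d_def)
  have "flow x 1 (displacement s0 s1 s2 (x, rep Y)) = (of_real d * fst y, fibre_lift d (snd y))"
  proof -
    have "cis (angle s1 (of_real d * q)) = of_real d * q"
      by (rule cis_angle) (use dz q in \<open>auto simp: norm_mult d_def\<close>)
    moreover have "cis (angle s2 (fibre_lift d (snd y)) - angle s0 (snd x)) = fibre_lift d (snd y) / snd x"
    proof -
      have "cis (angle s2 (fibre_lift d (snd y))) = fibre_lift d (snd y)"
        by (rule cis_angle) (use norm_fibre_lift[of d "snd y"] dz y(1) in \<open>auto simp: d_def\<close>)
      moreover have "cis (angle s0 (snd x)) = snd x"
        by (rule cis_angle) (use x in auto)
      ultimately show ?thesis by (simp only: cis_divide [symmetric])
    qed
    moreover have "snd x \<noteq> 0" using x by auto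
    ultimately show ?thesis unfolding D flow_def using q(2) by (auto simp: mult.left_commute)
  qed
  also have "orb Z2_ant \<dots> = Y"
    unfolding y(2) orb_eq_iff using dz
    by (auto simp: d_def fibre_lift_def sigma_ant_def complex_eq_iff prod_eq_iff)
  finally show ?thesis .
qed

abbreviation klein_base :: "nat \<Rightarrow> ((complex \<times> complex) \<times> (nat \<Rightarrow> (complex \<times> complex) set)) topology" where
  "klein_base n \<equiv> effl_base Sigma1_ant Z2_ant n"

lemma continuous_map_klein_base_pair:
  assumes "j < n - 1"
  shows "continuous_map (klein_base n) (prod_topology Sigma1_ant klein) (\<lambda>u. (fst u, snd u j))"
proof -
  have "continuous_map (klein_base n) klein (\<lambda>u. snd u j)"
    unfolding effl_base_def
    using continuous_map_compose[OF continuous_map_snd continuous_map_product_projection[of j "{..<n-1}" "\<lambda>i. klein"]] assms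
    by (simp add: o_def)
  then show ?thesis
    by (intro continuous_map_pairedI) (auto simp: effl_base_def intro: continuous_map_fst)
qed

section \<open>Separating large from small real parts\<close>

definition level :: "(complex \<times> complex) \<times> (nat \<Rightarrow> (complex \<times> complex) set) \<Rightarrow> nat \<Rightarrow> real" where
  "level u i = (if i = 0 then Re (snd (fst u))
     else if odd i then level_base (fst u, snd u ((i - 1) div 2))
     else level_fibre (snd u (i div 2 - 1)))"

lemma level_simps:
  "level u 0 = Re (snd (fst u))"
  "level u (2*j+1) = level_base (fst u, snd u j)"
  "level u (2*j+2) = level_fibre (snd u j)"
  by (simp_all add: level_def)

lemma block_cases:
  fixes i m :: nat
  assumes "i < 2*m+1"
  obtains "i = 0" | j where "j < m" "i = 2*j+1" | j where "j < m" "i = 2*j+2"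
proof -
  have "i = 0 \<or> (\<exists>j<m. i = 2*j+1) \<or> (\<exists>j<m. i = 2*j+2)" using assms by presburger
  then show ?thesis using that by blast
qed

lemma continuous_map_level:
  assumes "i < 2*(n-1)+1"
  shows "continuous_map (klein_base n) euclideanreal (\<lambda>u. level u i)"
  using assms
proof (cases rule: block_cases)
  case 1
  have "continuous_map (klein_base n) Sigma1_ant fst"
    unfolding effl_base_def by (rule continuous_map_fst)
  from continuous_map_compose[OF this continuous_map_Re_snd] show ?thesis
    unfolding 1 level_simps by (simp add: o_def)
next
  case (2 j)
  show ?thesis
    unfolding 2 level_simps
    using continuous_map_compose[OF continuous_map_klein_base_pair[OF 2(1)] continuous_map_level_base]
    by (simp add: o_def)
next
  case (3 j)
  show ?thesis
    unfolding 3 level_simps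
    using continuous_map_compose[OF continuous_map_klein_base_pair[OF 3(1)] continuous_map_level_fibre]
    by (simp add: o_def)
qed

lemma openin_Collect_ball:
  assumes "finite I" "\<And>i. i \<in> I \<Longrightarrow> openin X {x \<in> topspace X. P i x}"
  shows "openin X {x \<in> topspace X. \<forall>i\<in>I. P i x}"
  using assms
proof (induction I rule: finite_induct)
  case (insert i I)
  then have "openin X ({x \<in> topspace X. P i x} \<inter> {x \<in> topspace X. \<forall>i\<in>I. P i x})"
    by (intro openin_Int) auto
  then show ?case by (rule back_subst) auto
qed simp

text \<open>The first set makes the branches selected by \<open>S\<close> continuous; the second
  keeps pieces of equal size apart.\<close>

definition piece :: "nat \<Rightarrow> nat set \<Rightarrow> ((complex \<times> complex) \<times> (nat \<Rightarrow> (complex \<times> complex) set)) set" where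
  "piece n S = {u \<in> topspace (klein_base n). \<forall>i\<in>{..<2*(n-1)+1}. if i \<in> S then level u i > -1 else level u i < 1} \<inter>
     {u \<in> topspace (klein_base n). \<forall>i\<in>S. \<forall>j\<in>{..<2*(n-1)+1} - S. level u j < level u i}"

lemma openin_piece:
  assumes "S \<subseteq> {..<2*(n-1)+1}"
  shows "openin (klein_base n) (piece n S)"
  unfolding piece_def
proof (intro openin_Int openin_Collect_ball)
  show "finite S" using assms finite_subset by blast
  fix i assume "i \<in> {..<2*(n-1)+1}"
  then show "openin (klein_base n) {u \<in> topspace (klein_base n). if i \<in> S then level u i > -1 else level u i < 1}"
    by (intro openin_halfline continuous_map_level) simp
next
  fix i j assume "i \<in> S" "j \<in> {..<2*(n-1)+1} - S"
  then have "continuous_map (klein_base n) euclideanreal (\<lambda>u. level u i - level u j)"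
    using assms by (intro continuous_map_diff continuous_map_level) auto
  from openin_halfline[OF this, of True 0] show "openin (klein_base n) {u \<in> topspace (klein_base n). level u j < level u i}"
    by simp
qed auto

text \<open>Distinct sets of equal size each have an element outside the other, and the levels at
  these two indices would have to be ordered both ways.\<close>

lemma disjoint_pieces:
  assumes "S \<subseteq> {..<2*(n-1)+1}" "T \<subseteq> {..<2*(n-1)+1}" "card S = card T" "u \<in> piece n S" "u \<in> piece n T"
  shows "S = T"
proof (rule ccontr)
  assume "S \<noteq> T"
  have fin: "finite S" "finite T" using assms(1,2) finite_subset by blast+
  have "\<not> S \<subseteq> T" "\<not> T \<subseteq> S" using card_subset_eq[OF fin(2)] card_subset_eq[OF fin(1)] \<open>S \<noteq> T\<close> assms(3) by auto
  then obtain i j where ij: "i \<in> S" "i \<notin> T" "j \<in> T" "j \<notin> S" by auto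
  with assms have "level u j < level u i" "level u i < level u j"
    unfolding piece_def by auto
  then show False by simp
qed

lemma pieces_cover:
  assumes "u \<in> topspace (klein_base n)"
  obtains S where "S \<subseteq> {..<2*(n-1)+1}" "u \<in> piece n S"
proof
  \<comment> \<open>All indices off the lower cut. The remaining levels are at most -1, hence below
    1 and below every level in \<open>S\<close>.\<close>
  define S where "S = {i. i < 2*(n-1)+1 \<and> level u i > -1}"
  show "S \<subseteq> {..<2*(n-1)+1}" unfolding S_def by auto
  have "u \<in> piece n S" unfolding piece_def S_def using assms by auto
  then show "u \<in> piece n S" .
qed

lemma piece_branch_domain:
  assumes "u \<in> piece n S" "j < n - 1"
  shows "(fst u, snd u j) \<in> branch_domain (0 \<in> S) (2*j+1 \<in> S) (2*j+2 \<in> S)"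
proof -
  have u: "u \<in> topspace (klein_base n)"
    "\<And>i. i < 2*(n-1)+1 \<Longrightarrow> if i \<in> S then level u i > -1 else level u i < 1"
    using assms(1) unfolding piece_def by auto
  have "(fst u, snd u j) \<in> topspace (prod_topology Sigma1_ant klein)"
    using continuous_map_klein_base_pair[OF assms(2)] u(1) unfolding continuous_map_def by blast
  then show ?thesis
    using u(2)[of 0] u(2)[of "2*j+1"] u(2)[of "2*j+2"] assms(2)
    unfolding branch_domain_def level_simps by simp
qed

lemma continuous_map_flow:
  assumes "continuous_map X Sigma1_ant a" "continuous_map X euclidean t" "continuous_map X euclidean v"
  shows "continuous_map X Sigma1_ant (\<lambda>z. flow (a z) (t z) (v z))"
proof -
  have a: "continuous_map X euclidean a" "\<And>z. z \<in> topspace X \<Longrightarrow> a z \<in> torus"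
    using assms(1) unfolding Sigma1_ant_def continuous_map_in_subtopology by auto
  have "continuous_map X euclidean (\<lambda>z. (a z, (t z, v z)))"
    using continuous_map_pairedI[OF a(1) continuous_map_pairedI[OF assms(2,3)]] by simp
  moreover have "continuous_map euclidean euclidean (\<lambda>(a, (t, v)). flow a t v)"
    by (auto simp: flow_def case_prod_unfold intro!: continuous_intros)
  ultimately have "continuous_map X euclidean ((\<lambda>(a, (t, v)). flow a t v) \<circ> (\<lambda>z. (a z, (t z, v z))))"
    by (rule continuous_map_compose)
  then have "continuous_map X euclidean (\<lambda>z. flow (a z) (t z) (v z))"
    by (simp add: o_def)
  moreover have "flow (a z) (t z) (v z) \<in> torus" if "z \<in> topspace X" for z
    using a(2)[OF that] by (auto simp: flow_def norm_mult mem_Times_iff)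
  ultimately show ?thesis
    unfolding Sigma1_ant_def continuous_map_in_subtopology by auto
qed

lemma effl_section_over_piece:
  assumes "n \<ge> 2"
  shows "effl_section_over Sigma1_ant Z2_ant n (piece n S)"
  unfolding effl_section_over_def
proof (intro exI conjI)
  define v where "v u j = displacement (0 \<in> S) (2*j+1 \<in> S) (2*j+2 \<in> S) (fst u, rep (snd u j))"
    for u :: "(complex \<times> complex) \<times> (nat \<Rightarrow> (complex \<times> complex) set)" and j
  \<comment> \<open>The path with index 0 is constant at x, so all paths start there; index
    \<open>i > 0\<close> uses orbit coordinate \<open>i - 1\<close>.\<close>
  define H where "H = (\<lambda>(u, t). \<lambda>i\<in>{..<n}. if i = 0 then fst u else flow (fst u) t (v u (i - 1)))"
  let ?X = "prod_topology (subtopology (klein_base n) (piece n S)) (top_of_set {0..1::real})"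
  have proj: "continuous_map ?X (subtopology (klein_base n) (piece n S)) fst"
    by (rule continuous_map_fst)
  have cf: "continuous_map ?X Sigma1_ant (\<lambda>z. fst (fst z))"
    using continuous_map_compose[OF proj continuous_map_from_subtopology[of _ Sigma1_ant fst]]
    by (simp add: o_def effl_base_def continuous_map_fst)
  have ct: "continuous_map ?X euclidean snd"
    using continuous_map_snd continuous_map_into_fulltopology by blast
  have cv: "continuous_map ?X euclidean (\<lambda>z. v (fst z) j)" if j: "j < n - 1" for j
  proof -
    have "continuous_map (subtopology (klein_base n) (piece n S))
        (subtopology (prod_topology Sigma1_ant klein) (branch_domain (0 \<in> S) (2*j+1 \<in> S) (2*j+2 \<in> S)))
        (\<lambda>u. (fst u, snd u j))"
      unfolding continuous_map_in_subtopology
      using continuous_map_from_subtopology[OF continuous_map_klein_base_pair[OF j]] piece_branch_domain[OF _ j]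
      by (auto simp del: topspace_prod_topology)
    from continuous_map_compose[OF proj continuous_map_compose[OF this continuous_map_displacement]]
    show ?thesis by (simp add: v_def o_def)
  qed
  show "continuous_map ?X (product_topology (\<lambda>i. Sigma1_ant) {..<n}) H"
    unfolding continuous_map_componentwise
  proof (intro conjI ballI)
    show "H ` topspace ?X \<subseteq> extensional {..<n}" unfolding H_def by auto
    fix i assume i: "i \<in> {..<n}"
    show "continuous_map ?X Sigma1_ant (\<lambda>z. H z i)"
    proof (cases "i = 0")
      case True
      then show ?thesis using cf i by (simp add: H_def case_prod_unfold)
    next
      case False
      then have "continuous_map ?X Sigma1_ant (\<lambda>z. flow (fst (fst z)) (snd z) (v (fst z) (i - 1)))"
        using i by (intro continuous_map_flow cf ct cv) auto
      then show ?thesis using False i by (simp add: H_def case_prod_unfold)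
    qed
  qed
  show "\<forall>u\<in>piece n S. (\<forall>i<n. \<forall>j<n. H (u, 0) i = H (u, 0) j) \<and> H (u, 1) 0 = fst u \<and>
      (\<forall>i. 1 \<le> i \<and> i < n \<longrightarrow> orb Z2_ant (H (u, 1) i) = snd u (i - 1))"
  proof (intro ballI conjI allI impI)
    fix u i j assume "u \<in> piece n S" "i < n" "j < n"
    then show "H (u, 0) i = H (u, 0) j" by (simp add: H_def flow_0)
  next
    fix u assume "u \<in> piece n S"
    show "H (u, 1) 0 = fst u" using assms by (simp add: H_def)
  next
    fix u i assume u: "u \<in> piece n S" and i: "1 \<le> i \<and> i < n"
    show "orb Z2_ant (H (u, 1) i) = snd u (i - 1)"
      using orb_flow_displacement[OF piece_branch_domain[OF u, of "i - 1"]] i by (auto simp: H_def v_def)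
  qed
qed

text \<open>Sections on disjoint open sets paste without any compatibility condition; this lets all
  index sets of one size share a single member of the cover.\<close>

lemma effl_section_over_disjoint_Union:
  assumes ope: "\<And>S. S \<in> \<S> \<Longrightarrow> openin (effl_base X G n) (V S)"
    and sec: "\<And>S. S \<in> \<S> \<Longrightarrow> effl_section_over X G n (V S)"
    and disj: "\<And>S T u. S \<in> \<S> \<Longrightarrow> T \<in> \<S> \<Longrightarrow> u \<in> V S \<Longrightarrow> u \<in> V T \<Longrightarrow> S = T"
  shows "effl_section_over X G n (\<Union>S\<in>\<S>. V S)"
proof -
  let ?W = "\<Union>S\<in>\<S>. V S"
  let ?I = "top_of_set {0..1::real}"
  define P where "P S H \<longleftrightarrow> continuous_map (prod_topology (subtopology (effl_base X G n) (V S)) ?I)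
                       (product_topology (\<lambda>i. X) {..<n}) H
      \<and> (\<forall>u\<in>V S. (\<forall>i<n. \<forall>j<n. H (u,0) i = H (u,0) j)
                \<and> H (u,1) 0 = fst u
                \<and> (\<forall>i. 1 \<le> i \<and> i < n \<longrightarrow> orb G (H (u,1) i) = snd u (i - 1)))" for S H
  have "\<forall>S\<in>\<S>. \<exists>H. P S H" using sec unfolding effl_section_over_def P_def by blast
  then obtain H where H: "\<And>S. S \<in> \<S> \<Longrightarrow> P S (H S)" by metis
  define K where "K z = H (THE S. S \<in> \<S> \<and> fst z \<in> V S) z" for z
  have the: "(THE S. S \<in> \<S> \<and> u \<in> V S) = S" if "S \<in> \<S>" "u \<in> V S" for S u
  proof (rule the_equality)
    show "T = S" if "T \<in> \<S> \<and> u \<in> V T" for T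
      using disj[of T S u] that \<open>S \<in> \<S>\<close> \<open>u \<in> V S\<close> by blast
  qed (use that in blast)
  have K: "K (u, t) = H S (u, t)" if "S \<in> \<S>" "u \<in> V S" for S u t
    unfolding K_def using the[OF that] by simp
  have "continuous_map (prod_topology (subtopology (effl_base X G n) ?W) ?I) (product_topology (\<lambda>i. X) {..<n}) K"
  proof (rule pasting_lemma[where I = \<S> and T = "\<lambda>S. V S \<times> {0..1}" and f = H])
    fix S assume S: "S \<in> \<S>"
    have "openin (subtopology (effl_base X G n) ?W) (V S)"
      unfolding openin_subtopology by (rule exI[of _ "V S"]) (use ope[OF S] S in auto)
    then show "openin (prod_topology (subtopology (effl_base X G n) ?W) ?I) (V S \<times> {0..1})"
      by (simp add: openin_prod_Times_iff)
    have "subtopology (prod_topology (subtopology (effl_base X G n) ?W) ?I) (V S \<times> {0..1})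
        = prod_topology (subtopology (effl_base X G n) (V S)) ?I"
      using S by (simp add: subtopology_Times subtopology_subtopology Int_absorb1 SUP_upper)
    then show "continuous_map (subtopology (prod_topology (subtopology (effl_base X G n) ?W) ?I) (V S \<times> {0..1}))
        (product_topology (\<lambda>i. X) {..<n}) (H S)"
      using H[OF S] unfolding P_def by simp
  next
    fix S T z assume "S \<in> \<S>" "T \<in> \<S>"
      "z \<in> topspace (prod_topology (subtopology (effl_base X G n) ?W) ?I) \<inter> (V S \<times> {0..1}) \<inter> (V T \<times> {0..1})"
    then have "S = T" by (intro disj[of S T "fst z"]) (auto simp: mem_Times_iff)
    then show "H S z = H T z" by simp
  next
    fix z assume "z \<in> topspace (prod_topology (subtopology (effl_base X G n) ?W) ?I)"
    then obtain S where S: "S \<in> \<S>" "fst z \<in> V S" "snd z \<in> {0..1}" by auto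
    then have "K z = H S z" using K[of S "fst z" "snd z"] by simp
    then show "\<exists>S. S \<in> \<S> \<and> z \<in> V S \<times> {0..1} \<and> K z = H S z"
      using S by (intro exI[of _ S]) (simp add: mem_Times_iff)
  qed
  moreover have "\<forall>u\<in>?W. (\<forall>i<n. \<forall>j<n. K (u,0) i = K (u,0) j) \<and> K (u,1) 0 = fst u
                \<and> (\<forall>i. 1 \<le> i \<and> i < n \<longrightarrow> orb G (K (u,1) i) = snd u (i - 1))"
  proof
    fix u assume "u \<in> ?W"
    then obtain S where S: "S \<in> \<S>" "u \<in> V S" by auto
    then show "(\<forall>i<n. \<forall>j<n. K (u,0) i = K (u,0) j) \<and> K (u,1) 0 = fst u
                \<and> (\<forall>i. 1 \<le> i \<and> i < n \<longrightarrow> orb G (K (u,1) i) = snd u (i - 1))"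
      using H[OF S(1)] unfolding P_def K[OF S] by blast
  qed
  ultimately show ?thesis unfolding effl_section_over_def by blast
qed

lemma TC_effl_klein_le:
  assumes "n \<ge> 2"
  shows "TC_effl Sigma1_ant Z2_ant n \<le> enat (2 * n)"
proof -
  define U where "U k = (\<Union>S\<in>{S. S \<subseteq> {..<2*(n-1)+1} \<and> card S = k}. piece n S)" for k
  have "openin (klein_base n) (U k) \<and> effl_section_over Sigma1_ant Z2_ant n (U k)" for k
  proof
    show "openin (klein_base n) (U k)"
      unfolding U_def by (rule openin_Union) (auto simp: openin_piece)
    show "effl_section_over Sigma1_ant Z2_ant n (U k)"
      unfolding U_def
    proof (rule effl_section_over_disjoint_Union)
      fix S T u assume "S \<in> {S. S \<subseteq> {..<2*(n-1)+1} \<and> card S = k}" "T \<in> {S. S \<subseteq> {..<2*(n-1)+1} \<and> card S = k}"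
        "u \<in> piece n S" "u \<in> piece n T"
      then show "S = T" by (intro disjoint_pieces[of S n T u]) simp_all
    next
      fix S assume "S \<in> {S. S \<subseteq> {..<2*(n-1)+1} \<and> card S = k}"
      then show "openin (klein_base n) (piece n S)" by (simp add: openin_piece)
    qed (rule effl_section_over_piece[OF assms])
  qed
  moreover have "topspace (klein_base n) \<subseteq> (\<Union>k<2*n. U k)"
  proof
    fix u assume "u \<in> topspace (klein_base n)"
    then obtain S where S: "S \<subseteq> {..<2*(n-1)+1}" "u \<in> piece n S" by (rule pieces_cover)
    then have "card S \<le> card {..<2*(n-1)+1}" by (intro card_mono) auto
    \<comment> \<open>The sizes run from 0 to 2n - 1; counting the empty set gives 2n
      members.\<close>
    then have "card S < 2 * n" using assms by simp
    then show "u \<in> (\<Union>k<2*n. U k)" using S unfolding U_def by blast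
  qed
  ultimately show ?thesis
    unfolding TC_effl_def by (intro Inf_lower) blast
qed

section \<open>No cover by fewer open sets\<close>

text \<open>Endpoint of the lift through $z \mapsto z^2$, starting at 1, of a path starting at 1.\<close>
definition half_lift :: "(real \<Rightarrow> complex) \<Rightarrow> complex" where
  "half_lift f = (SOME r. \<exists>k. continuous_on {0..1} k \<and> k 0 = 1 \<and> (\<forall>t\<in>{0..1}. (k t)\<^sup>2 = f t) \<and> r = k 1)"

text \<open>The quotient of two lifts is continuous with square 1, hence constant on the interval,
  and it is 1 at time 0.\<close>

lemma half_lift_eq:
  assumes "continuous_on {0..1} k" "k 0 = 1" "\<And>t. t \<in> {0..1} \<Longrightarrow> (k t)\<^sup>2 = f t" "\<And>t. t \<in> {0..1} \<Longrightarrow> f t \<noteq> 0"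
  shows "half_lift f = k 1"
proof -
  have "r = k 1" if r: "\<exists>k. continuous_on {0..1} k \<and> k 0 = 1 \<and> (\<forall>t\<in>{0..1}. (k t)\<^sup>2 = f t) \<and> r = k 1" for r
  proof -
    obtain k' where k': "continuous_on {0..1} k'" "k' 0 = 1" "\<And>t. t \<in> {0..1} \<Longrightarrow> (k' t)\<^sup>2 = f t" "r = k' 1"
      using r by auto
    have nz: "k t \<noteq> 0" if "t \<in> {0..1}" for t using assms(3,4)[OF that] by auto
    have sq: "(k' t / k t)\<^sup>2 = 1" if "t \<in> {0..1}" for t
      using k'(3)[OF that] assms(3,4)[OF that] by (simp add: power_divide)
    have "(\<lambda>t. k' t / k t) constant_on {0..1}"
    proof (rule continuous_finite_range_constant)
      show "continuous_on {0..1} (\<lambda>t. k' t / k t)"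
        using assms(1) k'(1) nz by (intro continuous_intros) auto
      show "finite ((\<lambda>t. k' t / k t) ` {0..1})"
      proof (rule finite_subset)
        show "(\<lambda>t. k' t / k t) ` {0..1} \<subseteq> {1, -1}"
          using sq unfolding power2_eq_1_iff by blast
      qed simp
    qed auto
    then have "k' 1 / k 1 = k' 0 / k 0" unfolding constant_on_def by force
    then show ?thesis using nz[of 1] k' assms(2) by auto
  qed
  moreover have "\<exists>r k. continuous_on {0..1} k \<and> k 0 = 1 \<and> (\<forall>t\<in>{0..1}. (k t)\<^sup>2 = f t) \<and> r = k 1"
    using assms by blast
  ultimately show ?thesis unfolding half_lift_def by (rule someI2_ex[rotated])
qed

text \<open>The contractible square carries a square root \<open>g\<close> of the whole family.
  Since \<open>F (l, 0) = 1\<close>, dividing by \<open>g (l, 0)\<close> changes only a sign and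
  makes each lift start at 1.\<close>

lemma continuous_half_lift:
  fixes F :: "real \<times> real \<Rightarrow> complex"
  assumes F: "continuous_on ({0..1} \<times> {0..1}) F" "\<And>z. z \<in> {0..1} \<times> {0..1} \<Longrightarrow> F z \<noteq> 0"
    and F0: "\<And>l. l \<in> {0..1} \<Longrightarrow> F (l, 0) = 1"
  shows "continuous_on {0..1} (\<lambda>l. half_lift (\<lambda>t. F (l, t)))"
    and "l \<in> {0..1} \<Longrightarrow> (half_lift (\<lambda>t. F (l, t)))\<^sup>2 = F (l, 1)"
proof -
  have "contractible ({0..1::real} \<times> {0..1::real})"
    by (intro convex_imp_contractible convex_Times) auto
  then obtain g where g: "continuous_on ({0..1} \<times> {0..1}) g" "\<And>z. z \<in> {0..1} \<times> {0..1} \<Longrightarrow> F z = (g z)\<^sup>2"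
    using continuous_sqrt_on_contractible[OF F(1) _ F(2)] by metis
  have g0: "g z \<noteq> 0" if "z \<in> {0..1} \<times> {0..1}" for z using g(2)[OF that] F(2)[OF that] by auto
  have lift: "half_lift (\<lambda>t. F (l, t)) = g (l, 1) / g (l, 0)" if l: "l \<in> {0..1}" for l
  proof (rule half_lift_eq)
    have "continuous_on {0..1} (\<lambda>t. g (l, t))"
      by (rule continuous_on_compose2[OF g(1)]) (use l in \<open>auto intro!: continuous_intros\<close>)
    then show "continuous_on {0..1} (\<lambda>t. g (l, t) / g (l, 0))"
      using g0[of "(l, 0)"] l by (intro continuous_intros) auto
    show "(g (l, t) / g (l, 0))\<^sup>2 = F (l, t)" if "t \<in> {0..1}" for t
      using g(2)[of "(l, t)"] g(2)[of "(l, 0)"] F0[OF l] l that by (simp add: power_divide)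
    show "F (l, t) \<noteq> 0" if "t \<in> {0..1}" for t using F(2)[of "(l, t)"] l that by simp
  qed (use g0[of "(l, 0)"] l in auto)
  have "continuous_on {0..1} (\<lambda>l. g (l, t))" if "t \<in> {0..1}" for t
    by (rule continuous_on_compose2[OF g(1)]) (use that in \<open>auto intro!: continuous_intros\<close>)
  from this[of 1] this[of 0] have "continuous_on {0..1} (\<lambda>l. g (l, 1) / g (l, 0))"
    using g0 by (intro continuous_intros) auto
  then show "continuous_on {0..1} (\<lambda>l. half_lift (\<lambda>t. F (l, t)))"
    by (rule continuous_on_eq) (simp add: lift)
  show "(half_lift (\<lambda>t. F (l, t)))\<^sup>2 = F (l, 1)" if l: "l \<in> {0..1}"
    unfolding lift[OF l] using g(2)[of "(l, 1)"] g(2)[of "(l, 0)"] F0[OF l] l by (simp add: power_divide)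
qed

text \<open>Covering of the slice x' = 1. The base coordinate \<open>2*j+1\<close> runs at half
  speed: a unit step gives -1, which together with a reflection of the fibre is
  \<open>sigma_ant\<close>. So all deck generators have period 1.\<close>

definition param :: "nat \<Rightarrow> (nat \<Rightarrow> real) \<Rightarrow> (complex \<times> complex) \<times> (nat \<Rightarrow> (complex \<times> complex) set)" where
  "param n z = ((1, cis (2 * pi * z 0)),
     \<lambda>j\<in>{..<n-1}. orb Z2_ant (cis (pi * z (2*j+1)), cis (2 * pi * z (2*j+2))))"

lemma continuous_map_param: "continuous_map euclidean (klein_base n) (param n)"
proof -
  have proj: "continuous_on UNIV (\<lambda>z::nat \<Rightarrow> real. z i)" for i
    by (rule continuous_on_product_coordinates)
  have "continuous_map euclidean Sigma1_ant (\<lambda>z::nat \<Rightarrow> real. (1, cis (2 * pi * z 0)))"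
    unfolding Sigma1_ant_def continuous_map_in_subtopology
    by (auto intro!: continuous_intros proj simp: norm_mult)
  moreover have "continuous_map euclidean klein (\<lambda>z::nat \<Rightarrow> real. orb Z2_ant (cis (pi * z (2*j+1)), cis (2 * pi * z (2*j+2))))" for j
  proof -
    have "continuous_map euclidean Sigma1_ant (\<lambda>z::nat \<Rightarrow> real. (cis (pi * z (2*j+1)), cis (2 * pi * z (2*j+2))))"
      unfolding Sigma1_ant_def continuous_map_in_subtopology
      by (auto intro!: continuous_intros proj simp: norm_mult)
    from continuous_map_compose[OF this continuous_map_orb] show ?thesis by (simp add: o_def)
  qed
  ultimately show ?thesis
    unfolding effl_base_def continuous_map_pairwise o_def param_def continuous_map_componentwise
    by auto
qed

lemma cis_pi_add: "cis (pi * (x + 1)) = - cis (pi * x)" "cis (2 * pi * (x + 1)) = cis (2 * pi * x)"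
  by (simp_all add: distrib_left cis_mult[symmetric])

lemma cis_pi_square: "(cis (pi * x))\<^sup>2 = cis (2 * pi * x)"
  by (simp add: power2_eq_square cis_mult mult.assoc)

lemma cis_neq_minus: "cis x \<noteq> - cis x"
proof
  assume "cis x = - cis x"
  then have "cis x + cis x = 0" by (simp only: eq_neg_iff_add_eq_0)
  then have "2 * cis x = 0" by simp
  then show False by simp
qed

lemma param_shift:
  "param n (z(0 := z 0 + 1)) = param n z"
  "param n (z(2*i+2 := z (2*i+2) + 1)) = param n z"
  "param n (z(2*i+1 := z (2*i+1) + 1, 2*i+2 := - z (2*i+2))) = param n z"
proof -
  have *: "2*a+1 \<noteq> 2*b+2" for a b :: nat by presburger
  show "param n (z(0 := z 0 + 1)) = param n z"
    unfolding param_def by (auto simp: cis_pi_add)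
  show "param n (z(2*i+2 := z (2*i+2) + 1)) = param n z"
  proof -
    have "orb Z2_ant (cis (pi * (z(2*i+2 := z (2*i+2) + 1)) (2*j+1)), cis (2 * pi * (z(2*i+2 := z (2*i+2) + 1)) (2*j+2)))
      = orb Z2_ant (cis (pi * z (2*j+1)), cis (2 * pi * z (2*j+2)))" for j
      using * by (cases "i = j") (simp_all add: cis_pi_add)
    then show ?thesis unfolding param_def by auto
  qed
  have s: "orb Z2_ant (cis (pi * (x + 1)), cis (2 * pi * (- w))) = orb Z2_ant (cis (pi * x), cis (2 * pi * w))" for x w
    unfolding orb_eq_iff cis_pi_add by (simp add: sigma_ant_def cis_cnj)
  have "orb Z2_ant (cis (pi * (z(2*i+1 := z (2*i+1) + 1, 2*i+2 := - z (2*i+2))) (2*j+1)),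
      cis (2 * pi * (z(2*i+1 := z (2*i+1) + 1, 2*i+2 := - z (2*i+2))) (2*j+2)))
      = orb Z2_ant (cis (pi * z (2*j+1)), cis (2 * pi * z (2*j+2)))" for j
    using s[of "z (2*i+1)" "z (2*i+2)"] by (cases "i = j") auto
  then show "param n (z(2*i+1 := z (2*i+1) + 1, 2*i+2 := - z (2*i+2))) = param n z"
    unfolding param_def by auto
qed

text \<open>A section transports the square root $e^{\pi i z_0}$ of $x''$ along its path to a square root
  of the second coordinate of the chosen lift of $y_j$; the sign compares it with
  $e^{\pi i z_{2j+2}}$, or with the conjugate if the lift is the other point of the orbit.\<close>
definition section_sign ::
    "nat \<Rightarrow> (((complex \<times> complex) \<times> (nat \<Rightarrow> (complex \<times> complex) set)) \<times> real \<Rightarrow> nat \<Rightarrow> complex \<times> complex)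
      \<Rightarrow> nat \<Rightarrow> (nat \<Rightarrow> real) \<Rightarrow> complex" where
  "section_sign n H j z =
     (let u = param n z;
          r = half_lift (\<lambda>t. snd (H (u, t) (Suc j)) / snd (H (u, t) 0)) * cis (pi * z 0)
      in if fst (H (u, 1) (Suc j)) = cis (pi * z (2*j+1))
         then r / cis (pi * z (2*j+2)) else r * cis (pi * z (2*j+2)))"

context
  fixes n :: nat and U and H :: "((complex \<times> complex) \<times> (nat \<Rightarrow> (complex \<times> complex) set)) \<times> real \<Rightarrow> nat \<Rightarrow> complex \<times> complex"
  assumes H: "continuous_map (prod_topology (subtopology (klein_base n) U) (top_of_set {0..1}))
                       (product_topology (\<lambda>i. Sigma1_ant) {..<n}) H"
    and HU: "\<forall>u\<in>U. (\<forall>i<n. \<forall>j<n. H (u,0) i = H (u,0) j) \<and> H (u,1) 0 = fst u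
                \<and> (\<forall>i. 1 \<le> i \<and> i < n \<longrightarrow> orb Z2_ant (H (u,1) i) = snd u (i - 1))"
begin

lemma section_along_path:
  assumes \<gamma>: "continuous_on {0..1} \<gamma>" "\<And>l. l \<in> {0..1::real} \<Longrightarrow> param n (\<gamma> l) \<in> U" and i: "i < n"
  shows "continuous_on ({0..1} \<times> {0..1}) (\<lambda>(l, t). H (param n (\<gamma> l), t) i)"
    and "\<And>l t. l \<in> {0..1} \<Longrightarrow> t \<in> {0..1} \<Longrightarrow> H (param n (\<gamma> l), t) i \<in> torus"
proof -
  let ?I2 = "top_of_set ({0..1::real} \<times> {0..1::real})"
  have "continuous_map (top_of_set {0..1}) (klein_base n) (\<lambda>l. param n (\<gamma> l))"
    using continuous_map_compose[of "top_of_set {0..1}" euclidean \<gamma>, OF _ continuous_map_param] \<gamma>(1)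
    by (simp add: o_def)
  then have 1: "continuous_map (top_of_set {0..1}) (subtopology (klein_base n) U) (\<lambda>l. param n (\<gamma> l))"
    using \<gamma>(2) by (auto simp: continuous_map_in_subtopology)
  have 2: "continuous_map ?I2 (top_of_set {0..1}) fst" "continuous_map ?I2 (top_of_set {0..1}) snd"
    by (auto intro!: continuous_intros)
  have "continuous_map ?I2 (prod_topology (subtopology (klein_base n) U) (top_of_set {0..1})) (\<lambda>z. (param n (\<gamma> (fst z)), snd z))"
    using continuous_map_compose[OF 2(1) 1] 2(2) by (intro continuous_map_pairedI) (auto simp: o_def)
  from continuous_map_compose[OF continuous_map_compose[OF this H] continuous_map_product_projection[of i "{..<n}"]]
  have *: "continuous_map ?I2 Sigma1_ant (\<lambda>z. H (param n (\<gamma> (fst z)), snd z) i)"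
    using i by (simp add: o_def)
  then show "continuous_on ({0..1} \<times> {0..1}) (\<lambda>(l, t). H (param n (\<gamma> l), t) i)"
    unfolding Sigma1_ant_def by (simp add: case_prod_unfold)
  show "H (param n (\<gamma> l), t) i \<in> torus" if "l \<in> {0..1}" "t \<in> {0..1}" for l t
  proof -
    have "(\<lambda>z. H (param n (\<gamma> (fst z)), snd z) i) \<in> {0..1} \<times> {0..1} \<rightarrow> torus"
      using * unfolding Sigma1_ant_def by simp
    from funcset_mem[OF this, of "(l, t)"] show ?thesis using that by simp
  qed
qed

lemma section_endpoint:
  assumes "param n z \<in> U" "j < n - 1"
  shows "H (param n z, 1) (Suc j) = (cis (pi * z (2*j+1)), cis (2 * pi * z (2*j+2))) \<or>
         H (param n z, 1) (Suc j) = (- cis (pi * z (2*j+1)), cis (- 2 * pi * z (2*j+2)))"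
proof -
  have "orb Z2_ant (H (param n z, 1) (Suc j)) = snd (param n z) j"
    using bspec[OF HU assms(1)] assms(2) by (simp add: less_diff_conv)
  also have "\<dots> = orb Z2_ant (cis (pi * z (2*j+1)), cis (2 * pi * z (2*j+2)))"
    using assms(2) by (simp add: param_def)
  finally show ?thesis unfolding orb_eq_iff by (auto simp: sigma_ant_def cis_cnj)
qed

text \<open>The selected point of the orbit cannot switch along the path, and then the sign is
  continuous with square 1. This makes the cochain attached to \<open>U\<close> constant over a cube
  in the preimage of \<open>U\<close>.\<close>

lemma section_sign_along_path:
  assumes \<gamma>: "continuous_on {0..1} \<gamma>" "\<And>l. l \<in> {0..1::real} \<Longrightarrow> param n (\<gamma> l) \<in> U" and j: "j < n - 1"
  shows "section_sign n H j (\<gamma> 1) = section_sign n H j (\<gamma> 0)"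
    and "section_sign n H j (\<gamma> 0) \<in> {1, -1}"
proof -
  have jn: "Suc j < n" "0 < n" using j by auto
  define F where "F = (\<lambda>(l, t). snd (H (param n (\<gamma> l), t) (Suc j)) / snd (H (param n (\<gamma> l), t) 0))"
  have nz: "snd (H (param n (\<gamma> l), t) i) \<noteq> 0" if "l \<in> {0..1}" "t \<in> {0..1}" "i < n" for l t i
    using section_along_path(2)[OF \<gamma> that(3,1,2)] by (auto simp: mem_Times_iff)
  have cF: "continuous_on ({0..1} \<times> {0..1}) F"
    using section_along_path(1)[OF \<gamma> jn(1)] section_along_path(1)[OF \<gamma> jn(2)] nz jn
    unfolding F_def case_prod_unfold by (intro continuous_intros) auto
  \<comment> \<open>The common starting point of the paths enters here: the ratio of second
    coordinates starts at 1, as \<open>half_lift\<close> requires.\<close>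
  have F0: "F (l, 0) = 1" if "l \<in> {0..1}" for l
  proof -
    have "H (param n (\<gamma> l), 0) (Suc j) = H (param n (\<gamma> l), 0) 0"
      using HU \<gamma>(2)[OF that] jn by blast
    then show ?thesis using nz[OF that, of 0 0] jn by (simp add: F_def)
  qed
  have Fnz: "F z \<noteq> 0" if "z \<in> {0..1} \<times> {0..1}" for z
    using that nz[of "fst z" "snd z" "Suc j"] nz[of "fst z" "snd z" 0] jn
    by (simp add: F_def case_prod_unfold mem_Times_iff)
  define R where "R l = half_lift (\<lambda>t. F (l, t))" for l
  have lift: "continuous_on {0..1} R" "\<And>l. l \<in> {0..1} \<Longrightarrow> (R l)\<^sup>2 = F (l, 1)"
    unfolding R_def using continuous_half_lift[of F] cF Fnz F0 by simp_all
  have coord: "continuous_on {0..1} (\<lambda>l. cis (pi * \<gamma> l i))" for i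
  proof -
    have "continuous_on {0..1} (\<lambda>l. \<gamma> l i)" using \<gamma>(1) by (rule continuous_on_product_then_coordinatewise)
    then show ?thesis by (intro continuous_intros continuous_on_compose2[OF continuous_on_cis]) auto
  qed
  have R2: "(R l * cis (pi * \<gamma> l 0))\<^sup>2 = snd (H (param n (\<gamma> l), 1) (Suc j))" if "l \<in> {0..1}" for l
  proof -
    have "snd (H (param n (\<gamma> l), 1) 0) = cis (2 * pi * \<gamma> l 0)"
      using bspec[OF HU \<gamma>(2)[OF that]] by (simp add: param_def)
    then show ?thesis using lift(2)[OF that] by (simp add: F_def power_mult_distrib cis_pi_square)
  qed
  \<comment> \<open>Records which point of the orbit the section selects: 1 if its first coordinate
    is the reference value, -1 for the other point.\<close>
  define \<alpha> where "\<alpha> l = fst (H (param n (\<gamma> l), 1) (Suc j)) / cis (pi * \<gamma> l (2*j+1))" for l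
  have "\<alpha> constant_on {0..1}"
  proof (rule continuous_finite_range_constant)
    have "continuous_on {0..1} (\<lambda>l. H (param n (\<gamma> l), 1) (Suc j))"
      using continuous_on_compose2[OF section_along_path(1)[OF \<gamma> jn(1)], of "{0..1}" "\<lambda>l. (l, 1)"]
      by (force intro!: continuous_intros)
    then show "continuous_on {0..1} \<alpha>"
      unfolding \<alpha>_def by (intro continuous_on_divide continuous_on_fst coord) auto
    show "finite (\<alpha> ` {0..1})"
    proof (rule finite_subset)
      have "\<alpha> l = 1 \<or> \<alpha> l = -1" if "l \<in> {0..1}" for l
        using section_endpoint[OF \<gamma>(2)[OF that] j] unfolding \<alpha>_def by auto
      then show "\<alpha> ` {0..1} \<subseteq> {1, -1}" by blast
    qed simp
  qed auto
  then obtain c where c: "\<And>l. l \<in> {0..1} \<Longrightarrow> \<alpha> l = c" unfolding constant_on_def by auto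
  have sign: "section_sign n H j (\<gamma> l) = (if \<alpha> l = 1 then R l * cis (pi * \<gamma> l 0) / cis (pi * \<gamma> l (2*j+2))
      else R l * cis (pi * \<gamma> l 0) * cis (pi * \<gamma> l (2*j+2)))" for l
    by (simp add: section_sign_def Let_def R_def F_def \<alpha>_def)
  have rng: "section_sign n H j (\<gamma> l) \<in> {1, -1}" if l: "l \<in> {0..1}" for l
  proof -
    note sq = cis_pi_square[of "\<gamma> l (2*j+2)"]
    from cis_neq_minus[of "pi * \<gamma> l (2*j+1)"] section_endpoint[OF \<gamma>(2)[OF l] j] consider
       "\<alpha> l = 1" "snd (H (param n (\<gamma> l), 1) (Suc j)) = cis (2 * pi * \<gamma> l (2*j+2))"
     | "\<alpha> l \<noteq> 1" "snd (H (param n (\<gamma> l), 1) (Suc j)) = cis (- (2 * pi * \<gamma> l (2*j+2)))"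
      by (auto simp: \<alpha>_def)
    then have "(section_sign n H j (\<gamma> l))\<^sup>2 = 1"
    proof cases
      case 1
      then show ?thesis unfolding sign using R2[OF l] sq by (simp add: power_divide)
    next
      case 2
      then show ?thesis unfolding sign using R2[OF l] sq by (simp add: power_mult_distrib cis_mult)
    qed
    then show ?thesis by (simp add: power2_eq_1_iff)
  qed
  have "(\<lambda>l. section_sign n H j (\<gamma> l)) constant_on {0..1}"
  proof (rule continuous_finite_range_constant)
    have "continuous_on {0..1} (\<lambda>l. if c = 1 then R l * cis (pi * \<gamma> l 0) / cis (pi * \<gamma> l (2*j+2))
      else R l * cis (pi * \<gamma> l 0) * cis (pi * \<gamma> l (2*j+2)))"
      by (cases "c = 1") (simp_all add: lift(1) coord continuous_on_mult continuous_on_divide)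
    then show "continuous_on {0..1} (\<lambda>l. section_sign n H j (\<gamma> l))"
      by (rule continuous_on_eq) (simp add: sign c)
    show "finite ((\<lambda>l. section_sign n H j (\<gamma> l)) ` {0..1})"
      by (rule finite_subset[of _ "{1, -1}"]) (use rng in blast, simp)
  qed auto
  then show "section_sign n H j (\<gamma> 1) = section_sign n H j (\<gamma> 0)"
    unfolding constant_on_def by force
  show "section_sign n H j (\<gamma> 0) \<in> {1, -1}" using rng by simp
qed

lemma section_sign_cases:
  assumes "param n z \<in> U" "j < n - 1"
  shows "section_sign n H j z \<in> {1, -1}"
  using section_sign_along_path(2)[of "\<lambda>_. z"] assms by auto

text \<open>The shifts fix \<open>param n z\<close> and with it the section; only the reference
  values move. A unit step negates \<open>cis (pi * z 0)\<close> or the reference root of the fibre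
  that is shifted.\<close>

lemma section_sign_shift:
  assumes "param n z \<in> U" "j < n - 1"
  shows "section_sign n H j (z(0 := z 0 + 1)) = - section_sign n H j z"
    and "section_sign n H j (z(2*i+2 := z (2*i+2) + 1)) = (if i = j then - 1 else 1) * section_sign n H j z"
    and "section_sign n H j (z(2*i+1 := z (2*i+1) + 1, 2*i+2 := - z (2*i+2))) = section_sign n H j z"
proof -
  have *: "2*a+1 \<noteq> 2*b+2" "2*b+2 \<noteq> 2*a+1" for a b :: nat by presburger+
  show "section_sign n H j (z(0 := z 0 + 1)) = - section_sign n H j z"
    unfolding section_sign_def param_shift Let_def by (simp add: cis_pi_add)
  show "section_sign n H j (z(2*i+2 := z (2*i+2) + 1)) = (if i = j then - 1 else 1) * section_sign n H j z"
    unfolding section_sign_def param_shift Let_def fun_upd_apply using * by (auto simp: cis_pi_add)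
  show "section_sign n H j (z(2*i+1 := z (2*i+1) + 1, 2*i+2 := - z (2*i+2))) = section_sign n H j z"
  proof (cases "i = j")
    case False
    then show ?thesis unfolding section_sign_def param_shift Let_def fun_upd_apply using * by auto
  next
    case True
    \<comment> \<open>The flip negates the reference for the first coordinate, so the other branch
      of the conditional applies. Exchanging division and multiplication by the root of the fibre
      compensates for its coordinate changing sign.\<close>
    note cis_neq_minus[of "pi * z (2*j+1)"]
    moreover have "cis (- (pi * z (2*j+2))) = inverse (cis (pi * z (2*j+2)))"
      by simp
    ultimately show ?thesis
      using section_endpoint[OF assms]
      unfolding True section_sign_def param_shift Let_def fun_upd_apply
      using * by (auto simp: cis_pi_add divide_inverse)
  qed
qed

end

section \<open>A grid finer than a Lebesgue number\<close>

lemma compact_unit_cube_fun: "compact {z::nat \<Rightarrow> real. \<forall>i. z i \<in> {0..1}}"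
proof -
  have "compactin (product_topology (\<lambda>i. euclideanreal) UNIV) (PiE UNIV (\<lambda>i::nat. {0..1}))"
    by (simp add: compactin_PiE)
  moreover have "PiE UNIV (\<lambda>i::nat. {0..1::real}) = {z. \<forall>i. z i \<in> {0..1}}"
    by (auto simp: PiE_def Pi_def)
  ultimately show ?thesis
    by (simp add: euclidean_product_topology)
qed

text \<open>The metric on functions discounts late coordinates, whose share is bounded by
  \<open>(1/2) ^ M\<close>.\<close>

lemma dist_fun_le:
  fixes x y :: "nat \<Rightarrow> real"
  assumes "\<And>i. \<bar>x i - y i\<bar> \<le> c"
  shows "dist x y \<le> 2 * c + (1/2) ^ M"
proof -
  have "Max {dist (x (from_nat n)) (y (from_nat n)) |n. n \<le> M} \<le> c"
    by (subst Max_le_iff) (auto simp: dist_real_def assms)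
  with dist_fun_le_dist_first_terms[of x y M] show ?thesis by linarith
qed

lemma diameter_le_dist:
  assumes "T \<noteq> {}" "\<And>x y. x \<in> T \<Longrightarrow> y \<in> T \<Longrightarrow> dist x y \<le> d"
  shows "diameter T \<le> d"
proof -
  have "(SUP (x, y)\<in>T \<times> T. dist x y) \<le> d"
    by (rule cSUP_least) (use assms in auto)
  then show ?thesis using assms(1) by (simp add: diameter_def)
qed

text \<open>The radius is the step 1/P of the grid with \<open>P = 2 * int h\<close>, so the cube
  around the centre of a top cell contains that closed cell.\<close>

lemma Lebesgue_cubes:
  fixes \<C> :: "(nat \<Rightarrow> real) set set"
  assumes "\<And>B. B \<in> \<C> \<Longrightarrow> open B" "{z. \<forall>i. z i \<in> {0..1}} \<subseteq> \<Union>\<C>"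
  obtains h :: nat where "h > 0"
    "\<And>c. {z. \<forall>i. z i \<in> {0..1} \<and> \<bar>z i - c i\<bar> \<le> 1 / (2 * real h)} \<noteq> {} \<Longrightarrow>
       \<exists>B\<in>\<C>. {z. \<forall>i. z i \<in> {0..1} \<and> \<bar>z i - c i\<bar> \<le> 1 / (2 * real h)} \<subseteq> B"
proof -
  have "(\<lambda>_. 0) \<in> {z::nat \<Rightarrow> real. \<forall>i. z i \<in> {0..1}}" by simp
  then have "(\<lambda>_. 0) \<in> \<Union>\<C>" using assms(2) by (rule set_rev_mp)
  then have "\<C> \<noteq> {}" by auto
  then obtain \<delta> where \<delta>: "\<delta> > 0"
    "\<And>T. T \<subseteq> {z. \<forall>i. z i \<in> {0..1}} \<Longrightarrow> diameter T < \<delta> \<Longrightarrow> \<exists>B\<in>\<C>. T \<subseteq> B"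
    using Lebesgue_number_lemma[OF compact_unit_cube_fun _ assms(2,1)] by blast
  \<comment> \<open>The choices make \<open>2 / h\<close> and \<open>(1/2) ^ M\<close> each less
    than \<open>\<delta> / 4\<close>, so distances in a cube are at most
    \<open>\<delta> / 2\<close>, strictly below the Lebesgue number.\<close>
  obtain M where M: "(1/2::real) ^ M < \<delta> / 4"
    using real_arch_pow_inv[of "\<delta> / 4" "1/2"] \<delta>(1) by auto
  obtain h where h: "h > 0" "1 / real h < \<delta> / 8"
    using real_arch_inverse[of "\<delta> / 8"] \<delta>(1) by (auto simp: inverse_eq_divide)
  show ?thesis
  proof (rule that[OF h(1)])
    fix c assume ne: "{z::nat \<Rightarrow> real. \<forall>i. z i \<in> {0..1} \<and> \<bar>z i - c i\<bar> \<le> 1 / (2 * real h)} \<noteq> {}"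
    let ?T = "{z::nat \<Rightarrow> real. \<forall>i. z i \<in> {0..1} \<and> \<bar>z i - c i\<bar> \<le> 1 / (2 * real h)}"
    have "dist x y \<le> \<delta> / 2" if "x \<in> ?T" "y \<in> ?T" for x y
    proof -
      have "\<bar>x i - y i\<bar> \<le> 1 / real h" for i
      proof -
        have "\<bar>x i - c i\<bar> \<le> 1 / (2 * real h)" "\<bar>y i - c i\<bar> \<le> 1 / (2 * real h)" using that by auto
        moreover have "1 / real h = 1 / (2 * real h) + 1 / (2 * real h)" by simp
        ultimately show ?thesis by linarith
      qed
      then have "dist x y \<le> 2 * (1 / real h) + (1/2) ^ M" by (rule dist_fun_le)
      then show ?thesis using M h by linarith
    qed
    then have "diameter ?T \<le> \<delta> / 2"
      using ne by (intro diameter_le_dist) auto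
    then show "\<exists>B\<in>\<C>. ?T \<subseteq> B" using \<delta> by (intro \<delta>(2)) auto
  qed
qed

definition grid_point :: "int \<Rightarrow> (nat \<Rightarrow> int) \<Rightarrow> nat \<Rightarrow> real" where
  "grid_point P p i = of_int (p i) / of_int P"

lemma grid_point_shift:
  assumes "P > 0"
  shows "grid_point P (shift0 P p) = (grid_point P p)(0 := grid_point P p 0 + 1)"
    "grid_point P (shift_fibre P i p) = (grid_point P p)(2*i+2 := grid_point P p (2*i+2) + 1)"
    "grid_point P (shift_flip P i p) = (grid_point P p)(2*i+1 := grid_point P p (2*i+1) + 1, 2*i+2 := - grid_point P p (2*i+2))"
  using assms unfolding grid_point_def[abs_def] shift0_def shift_fibre_def shift_flip_def
  by (simp_all add: fun_eq_iff add_divide_distrib)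

lemma TC_effl_klein_ge:
  assumes n: "n \<ge> 2"
  shows "TC_effl Sigma1_ant Z2_ant n \<ge> enat (2 * n)"
proof -
  have bound: "2 * n \<le> K" if ope: "\<And>k. k < K \<Longrightarrow> openin (klein_base n) (U k)"
    and sec: "\<And>k. k < K \<Longrightarrow> effl_section_over Sigma1_ant Z2_ant n (U k)"
    and cov: "topspace (klein_base n) \<subseteq> (\<Union>k<K. U k)" for K U
  proof (rule ccontr)
    assume "\<not> 2 * n \<le> K"
    define m where "m = n - 1"
    define N where "N = 2*m+1"
    have m: "0 < m" and KN: "K \<le> N" using n \<open>\<not> 2 * n \<le> K\<close> by (auto simp: m_def N_def)
    define sect where "sect k H \<longleftrightarrow> continuous_map (prod_topology (subtopology (klein_base n) (U k)) (top_of_set {0..1::real}))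
                       (product_topology (\<lambda>i. Sigma1_ant) {..<n}) H
      \<and> (\<forall>u\<in>U k. (\<forall>i<n. \<forall>j<n. H (u,0) i = H (u,0) j) \<and> H (u,1) 0 = fst u
                \<and> (\<forall>i. 1 \<le> i \<and> i < n \<longrightarrow> orb Z2_ant (H (u,1) i) = snd u (i - 1)))" for k H
    have "\<forall>k\<in>{..<K}. \<exists>H. sect k H"
    proof
      fix k assume "k \<in> {..<K}"
      then show "\<exists>H. sect k H"
        using sec[of k] unfolding effl_section_over_def sect_def by simp
    qed
    from bchoice[OF this] obtain H where "\<And>k. k < K \<Longrightarrow> sect k (H k)" by auto
    note H = conjunct1[OF this[unfolded sect_def]] and HU = conjunct2[OF this[unfolded sect_def]]
    define V where "V k = {z. param n z \<in> U k}" for k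
    have V: "open (V k)" if "k < K" for k
      using openin_continuous_map_preimage[OF continuous_map_param ope[OF that]] by (simp add: V_def)
    have "param n z \<in> topspace (klein_base n)" for z
      using continuous_map_param[of n] unfolding continuous_map_def by auto
    then have "param n z \<in> (\<Union>k<K. U k)" for z using cov by (rule set_rev_mp)
    then have "{z. \<forall>i. z i \<in> {0..1}} \<subseteq> \<Union>(V ` {..<K})"
      by (auto simp: V_def)
    then obtain h :: nat where h: "h > 0"
      and cubes: "\<And>c. {z. \<forall>i. z i \<in> {0..1} \<and> \<bar>z i - c i\<bar> \<le> 1 / (2 * real h)} \<noteq> {} \<Longrightarrow>
       \<exists>B\<in>V ` {..<K}. {z. \<forall>i. z i \<in> {0..1} \<and> \<bar>z i - c i\<bar> \<le> 1 / (2 * real h)} \<subseteq> B"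
    proof (rule Lebesgue_cubes[rotated])
      show "open B" if "B \<in> V ` {..<K}" for B using that V by auto
    qed (rule that)
    define P where "P = 2 * int h"
    have P: "P > 0" "real_of_int P = 2 * real h" using h by (auto simp: P_def)
    define block where "block k = (k - 1) div 2" for k :: nat
    have block: "block k < n - 1" if "k < N" for k
      using that m unfolding block_def N_def m_def by linarith
    \<comment> \<open>\<open>wall_cochain\<close> fills in the values off U_k, and also for
      \<open>k \<ge> K\<close>, with the same character as the signs. The case distinction itself is
      invariant because \<open>param\<close> is, so \<open>b k\<close> has that character
      everywhere.\<close>
    define b where "b k p = (if k < K \<and> param n (grid_point P p) \<in> U k
        then of_bool (section_sign n (H k) (block k) (grid_point P p) \<noteq> 1) else wall_cochain P k p)" for k p
    note params = grid_point_shift[OF P(1)] param_shift wall_cochain_equivariant[OF P(1)]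
    have b0: "b k (shift0 P p) = b k p + 1"
      and bf: "b k (shift_fibre P i p) = b k p + of_bool (i = (k-1) div 2)"
      and bx: "b k (shift_flip P i p) = b k p" if kN: "k < N" for k i p
    proof -
      let ?z = "grid_point P p"
      show "b k (shift0 P p) = b k p + 1"
        "b k (shift_fibre P i p) = b k p + of_bool (i = (k-1) div 2)"
        "b k (shift_flip P i p) = b k p"
      proof (atomize (full), cases "k < K \<and> param n ?z \<in> U k")
        case True
        then have "k < K" "param n ?z \<in> U k" by auto
        note * = H[OF this(1)] HU[OF this(1)] this(2) block[OF kN]
        note shift = section_sign_shift[OF *]
        have "section_sign n (H k) (block k) ?z = 1 \<or> section_sign n (H k) (block k) ?z = -1"
          using section_sign_cases[OF *] by blast
        then show "b k (shift0 P p) = b k p + 1 \<and>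
          b k (shift_fibre P i p) = b k p + of_bool (i = (k-1) div 2) \<and> b k (shift_flip P i p) = b k p"
          unfolding b_def params shift using True by (auto simp: block_def)
      next
        case False
        then show "b k (shift0 P p) = b k p + 1 \<and>
          b k (shift_fibre P i p) = b k p + of_bool (i = (k-1) div 2) \<and> b k (shift_flip P i p) = b k p"
          unfolding b_def params by auto
      qed
    qed
    obtain p where p: "p \<in> odd_cells N P"
      and nonconst: "\<And>k c. k < N \<Longrightarrow> \<exists>q. (\<forall>i<N. \<bar>q i - p i\<bar> \<le> 1) \<and> (\<forall>i\<ge>N. q i = 0) \<and> b k q \<noteq> c"
      using odd_cell_nonconstant[where b = b, OF P_def h m N_def b0 bf bx] by blast
    define T where "T = {z. \<forall>i. z i \<in> {0..1} \<and> \<bar>z i - grid_point P p i\<bar> \<le> 1 / (2 * real h)}"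
    have T: "grid_point P q \<in> T" if "\<And>i. i < N \<Longrightarrow> \<bar>q i - p i\<bar> \<le> 1" "\<And>i. i \<ge> N \<Longrightarrow> q i = 0" for q
    proof -
      have "grid_point P q i \<in> {0..1} \<and> \<bar>grid_point P q i - grid_point P p i\<bar> \<le> 1 / (2 * real h)" for i
      proof -
        have "0 \<le> q i \<and> q i \<le> P \<and> \<bar>q i - p i\<bar> \<le> 1"
          using that[of i] p by (cases "i < N") (auto simp: odd_cells_def P_def)
        then have "0 \<le> real_of_int (q i) \<and> real_of_int (q i) \<le> real_of_int P \<and> \<bar>real_of_int (q i) - real_of_int (p i)\<bar> \<le> 1"
          by linarith
        moreover have "grid_point P q i - grid_point P p i = (real_of_int (q i) - real_of_int (p i)) / (2 * real h)"
          by (simp add: grid_point_def P(2) diff_divide_distrib)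
        ultimately show ?thesis
          using P h by (simp add: grid_point_def abs_divide divide_right_mono)
      qed
      then show ?thesis unfolding T_def by simp
    qed
    have pT: "grid_point P p \<in> T"
      by (rule T) (use p in \<open>auto simp: odd_cells_def\<close>)
    then have "T \<noteq> {}" by blast
    then obtain k where k: "k < K" "T \<subseteq> V k" using cubes[of "grid_point P p"] unfolding T_def[symmetric] by blast
    have kN: "k < N" using k KN by simp
    have const: "b k q = b k p" if q: "\<And>i. i < N \<Longrightarrow> \<bar>q i - p i\<bar> \<le> 1" "\<And>i. i \<ge> N \<Longrightarrow> q i = 0" for q
    proof -
      \<comment> \<open>The straight segment from the cell centre to the barycentre of a face stays
        in the convex set \<open>T\<close>, hence over U_k, so the section sign agrees at both
        ends.\<close>
      define \<gamma> where "\<gamma> l = (\<lambda>i. (1 - l) * grid_point P p i + l * grid_point P q i)" for l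
      have "\<gamma> l \<in> T" if l: "l \<in> {0..1}" for l
      proof -
        have "\<gamma> l i \<in> {0..1} \<and> \<bar>\<gamma> l i - grid_point P p i\<bar> \<le> 1 / (2 * real h)" for i
        proof -
          have q': "grid_point P q i \<in> {0..1}" "\<bar>grid_point P q i - grid_point P p i\<bar> \<le> 1 / (2 * real h)"
            and p': "grid_point P p i \<in> {0..1}"
            using T[OF q] pT unfolding T_def by auto
          have "\<gamma> l i - grid_point P p i = l * (grid_point P q i - grid_point P p i)"
            by (simp add: \<gamma>_def algebra_simps)
          then have "\<bar>\<gamma> l i - grid_point P p i\<bar> \<le> 1 * (1 / (2 * real h))"
            unfolding abs_mult using l q'(2) by (auto simp only: abs_mult intro!: mult_mono) auto
          moreover have "\<gamma> l i \<in> {0..1}"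
            using convexD[of "{0..1::real}" "grid_point P p i" "grid_point P q i" "1 - l" l] p' q'(1) l
            by (simp add: \<gamma>_def)
          ultimately show ?thesis by simp
        qed
        then show ?thesis unfolding T_def by simp
      qed
      then have inU: "param n (\<gamma> l) \<in> U k" if "l \<in> {0..1}" for l
        using k(2) that unfolding V_def by blast
      have "continuous_on {0..1} \<gamma>"
        unfolding \<gamma>_def by (intro continuous_on_coordinatewise_then_product continuous_intros)
      from section_sign_along_path(1)[OF H[OF k(1)] HU[OF k(1)] this inU block[OF kN]]
      have "section_sign n (H k) (block k) (\<gamma> 1) = section_sign n (H k) (block k) (\<gamma> 0)" .
      moreover have "\<gamma> 0 = grid_point P p" "\<gamma> 1 = grid_point P q" by (auto simp: \<gamma>_def)
      ultimately show ?thesis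
        using inU[of 0] inU[of 1] k(1) unfolding b_def by simp
    qed
    from nonconst[OF kN, of "b k p"] const show False by blast
  qed
  show ?thesis
    unfolding TC_effl_def
  proof (rule Inf_greatest, elim CollectE exE conjE)
    fix x K U assume x: "x = enat K"
      and U: "\<forall>i<K. openin (klein_base n) (U i) \<and> effl_section_over Sigma1_ant Z2_ant n (U i)"
        "topspace (klein_base n) \<subseteq> (\<Union>i<K. U i)"
    have "2 * n \<le> K" by (rule bound[of K U]) (use U in simp_all)
    then show "enat (2 * n) \<le> x" using x by simp
  qed
qed

theorem mainTheorem16:
  fixes n :: nat
  assumes "n \<ge> 2"
  shows "TC_effl Sigma1_ant Z2_ant n = enat (2 * n)"
  using TC_effl_klein_le[OF assms] TC_effl_klein_ge[OF assms] by (rule antisym)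

end
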